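(* Let $k,s\ge 1$ be integers and suppose that for each system $i\in\{1,\dots,k\}$ the observation vectors $(Y_{i1j},\dots,Y_{isj})$, $j=1,2,\dots$, are iid $s$-variate normal with mean $(y_{i1},\dots,y_{is})$ and positive definite covariance matrix $\Sigma_i$. Let the procedure $\mathcal{IZR}$ be run with initial sample size $n_0\ge 2$, nominal error $\alpha\in(0,1)$, integer $c\ge 1$, thresholds $q_\ell\in\mathbb{R}$, tolerance levels $\epsilon_\ell>0$, and relaxed tolerance levels $\epsilon_\ell^{(1)}>\cdots>\epsilon_\ell^{(T_\ell)}=\epsilon_\ell$ ($T_\ell\ge 1$), $\ell=1,\dots,s$. Then, both when the systems are mutually independent (with the corresponding choice of $\beta$) and when they may be arbitrarily dependent (with the other choice of $\beta$), $$\mathbf{P}\Big\{\bigcap_{i=1}^k\bigcap_{\ell=1}^s \mathrm{CD}_{i\ell}\Big\}\ \ge\ 1-\alpha .$$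
   Context: Setting. There are $k$ systems and $s$ constraints; $Y_{i\ell j}$ is the $j$th observation of performance measure $\ell$ of system $i$, with mean $y_{i\ell}$ and variance $\sigma_{i\ell}^2$. For each $i$ the vectors $(Y_{i1j},\dots,Y_{isj})$ are iid in $j$; observations of different systems may be dependent unless systems are said to be independent. Function $g$. For positive integers $c,n$ and $\eta>0$, $$g_n(\eta)=\sum_{m=1}^c(-1)^{m+1}\Big(1-\tfrac12\mathbb{I}(m=c)\Big)\Big(1+\tfrac{2\eta(2c-m)m}{c}\Big)^{-n/2},$$ with $\mathbb{I}$ the indicator function. Boundary. $R(r;v,w,z)=\max\{0,\frac{wz}{2cv}-\frac{v}{2c}r\}$. Parameters of $\mathcal{IZR}$. $\beta=[1-(1-\alpha)^{1/k}]/\sum_{\ell=1}^sT_\ell$ if the systems are independent, and $\beta=\alpha/(k\sum_{\ell=1}^sT_\ell)$ otherwise; $\eta>0$ satisfies $g_{n_0-1}(\eta)=\beta$; $h^2=2c\eta(n_0-1)$; $S_{i\ell}^2$ is the (unbiased) sample variance of $Y_{i\ell1},\dots,Y_{i\ell n_0}$. Procedure for constraint $\ell$ of system $i$ considered in isolation. For each $\epsilon\in\{\epsilon_\ell^{(1)},\dots,\epsilon_\ell^{(T_\ell)}\}$, two subroutines monitor, for $r=n_0,n_0+1,\dots$, the statistics $$\mathcal{F_U}:\ \sum_{j=1}^rY_{i\ell j}-r(q_\ell+\epsilon_\ell-\epsilon),\qquad \mathcal{F_D}:\ \sum_{j=1}^rY_{i\ell j}-r(q_\ell-\epsilon_\ell+\epsilon).$$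 Each subroutine stops at the first $r\ge n_0$ at which its statistic is $\le -R(r;\epsilon,h^2,S_{i\ell}^2)$ (decision $1$, "feasible") or else $\ge R(r;\epsilon,h^2,S_{i\ell}^2)$ (decision $-1$, "infeasible"). Denote the decisions by $Z_{\mathcal{U}i\ell}^{(\epsilon)}$ and $Z_{\mathcal{D}i\ell}^{(\epsilon)}$. The procedure stops at the first $r$ at which, for some $\epsilon$, both subroutines with that $\epsilon$ have stopped with equal decisions; this $\epsilon$ is denoted $\epsilon_{i\ell}^*$ (if several $\epsilon$ qualify at the same $r$, one is selected by a fixed deterministic tie-breaking rule), and the procedure declares system $i$ feasible for constraint $\ell$ if the common decision is $1$ and infeasible if it is $-1$. (For $\epsilon=\epsilon_\ell$ the two subroutines coincide.) Correct decision. If $y_{i\ell}\le q_\ell-\epsilon_\ell$, $\mathrm{CD}_{i\ell}$ is the event that system $i$ is declared feasible for constraint $\ell$; if $y_{i\ell}\ge q_\ell+\epsilon_\ell$, it is the event that system $i$ is declared infeasible for constraint $\ell$; if $q_\ell-\epsilon_\ell<y_{i\ell}<q_\ell+\epsilon_\ell$, any decision is correct, i.e. $\mathrm{CD}_{i\ell}$ is the sure event. The events $\mathrm{CD}_{i\ell}$ are understood with each constraint $\ell$ of each system $i$ run in isolation until a decision for it is made. *)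

theory Defs
  imports "HOL-Probability.Probability"
begin

definition pos_def_matrix :: "real ^ 'n ^ 'n \<Rightarrow> bool" where
  "pos_def_matrix \<Sigma> \<longleftrightarrow> transpose \<Sigma> = \<Sigma> \<and> (\<forall>x. x \<noteq> 0 \<longrightarrow> x \<bullet> (\<Sigma> *v x) > 0)"

text \<open>Density with respect to Lebesgue measure of the multivariate normal distribution with
  mean \<open>\<mu>\<close> and positive definite covariance matrix \<open>\<Sigma>\<close>.\<close>
definition mvn_density :: "real ^ 'n \<Rightarrow> real ^ 'n ^ 'n \<Rightarrow> real ^ 'n \<Rightarrow> real" where
  "mvn_density \<mu> \<Sigma> x =
     exp (- ((x - \<mu>) \<bullet> (matrix_inv \<Sigma> *v (x - \<mu>))) / 2) / sqrt ((2 * pi) ^ CARD('n) * det \<Sigma>)"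

text \<open>Observations are numbered from 1; \<open>X 0\<close> plays no role.\<close>
definition iid_mvn ::
  "'w measure \<Rightarrow> (nat \<Rightarrow> 'w \<Rightarrow> real ^ 'n) \<Rightarrow> real ^ 'n \<Rightarrow> real ^ 'n ^ 'n \<Rightarrow> bool" where
  "iid_mvn M X \<mu> \<Sigma> \<longleftrightarrow>
     prob_space.indep_vars M (\<lambda>_. borel) X {1..} \<and>
     (\<forall>j\<ge>1. distributed M lborel (X j) (\<lambda>x. ennreal (mvn_density \<mu> \<Sigma> x)))"

text \<open>Mutual independence of the systems: the whole observation processes
  \<open>(Y i j)\<close>, \<open>j \<ge> 1\<close>, are independent over \<open>i\<close>.\<close>
definition systems_independent ::
  "'w measure \<Rightarrow> ('k \<Rightarrow> nat \<Rightarrow> 'w \<Rightarrow> real ^ 'n) \<Rightarrow> bool" where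
  "systems_independent M Y \<longleftrightarrow>
     prob_space.indep_vars M (\<lambda>_. Pi\<^sub>M {1..} (\<lambda>_. borel)) (\<lambda>i \<omega>. \<lambda>j\<in>{1..}. Y i j \<omega>) UNIV"

definition g_fun :: "nat \<Rightarrow> nat \<Rightarrow> real \<Rightarrow> real" where
  "g_fun c n \<eta> = (\<Sum>m=1..c. (-1) ^ (m + 1) * (1 - (1/2) * of_bool (m = c)) *
     (1 + 2 * \<eta> * (2 * real c - real m) * real m / real c) powr (- real n / 2))"

definition boundary :: "nat \<Rightarrow> nat \<Rightarrow> real \<Rightarrow> real \<Rightarrow> real \<Rightarrow> real" where
  "boundary c r v w z = max 0 (w * z / (2 * real c * v) - v / (2 * real c) * real r)"

definition beta_indep :: "real \<Rightarrow> nat \<Rightarrow> nat \<Rightarrow> real" where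
  "beta_indep \<alpha> k N = (1 - (1 - \<alpha>) powr (1 / real k)) / real N"

definition beta_dep :: "real \<Rightarrow> nat \<Rightarrow> nat \<Rightarrow> real" where
  "beta_dep \<alpha> k N = \<alpha> / (real k * real N)"

definition h_squared :: "nat \<Rightarrow> nat \<Rightarrow> real \<Rightarrow> real" where
  "h_squared c n0 \<eta> = 2 * real c * \<eta> * (real n0 - 1)"

text \<open>From here on, \<open>x j\<close> is the \<open>j\<close>-th observation (\<open>j \<ge> 1\<close>) along one sample path of a single
  performance measure of a single system.\<close>

definition sample_mean :: "nat \<Rightarrow> (nat \<Rightarrow> real) \<Rightarrow> real" where
  "sample_mean n x = (\<Sum>j=1..n. x j) / real n"

definition sample_variance :: "nat \<Rightarrow> (nat \<Rightarrow> real) \<Rightarrow> real" where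
  "sample_variance n x = (\<Sum>j=1..n. (x j - sample_mean n x)\<^sup>2) / (real n - 1)"

text \<open>A subroutine monitors \<open>monitor a x r\<close> for a shifted threshold \<open>a\<close>, against the
  boundary \<open>\<plusminus> sub_bound\<close>.\<close>

definition monitor :: "real \<Rightarrow> (nat \<Rightarrow> real) \<Rightarrow> nat \<Rightarrow> real" where
  "monitor a x r = (\<Sum>j=1..r. x j) - real r * a"

definition sub_bound :: "nat \<Rightarrow> nat \<Rightarrow> real \<Rightarrow> real \<Rightarrow> (nat \<Rightarrow> real) \<Rightarrow> nat \<Rightarrow> real" where
  "sub_bound c n0 \<eta> \<epsilon> x r = boundary c r \<epsilon> (h_squared c n0 \<eta>) (sample_variance n0 x)"

text \<open>For \<open>c \<ge> 1\<close> and \<open>\<epsilon> > 0\<close> the boundary is 0 for all large \<open>r\<close>, so the set of stopping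
  candidates is nonempty on every path and \<open>LEAST\<close> is its minimum.\<close>
definition sub_stop :: "nat \<Rightarrow> nat \<Rightarrow> real \<Rightarrow> real \<Rightarrow> real \<Rightarrow> (nat \<Rightarrow> real) \<Rightarrow> nat" where
  "sub_stop c n0 \<eta> \<epsilon> a x = (LEAST r. n0 \<le> r \<and>
     (monitor a x r \<le> - sub_bound c n0 \<eta> \<epsilon> x r \<or> monitor a x r \<ge> sub_bound c n0 \<eta> \<epsilon> x r))"

definition sub_decision :: "nat \<Rightarrow> nat \<Rightarrow> real \<Rightarrow> real \<Rightarrow> real \<Rightarrow> (nat \<Rightarrow> real) \<Rightarrow> int" where
  "sub_decision c n0 \<eta> \<epsilon> a x = (let r = sub_stop c n0 \<eta> \<epsilon> a x in
     if monitor a x r \<le> - sub_bound c n0 \<eta> \<epsilon> x r then 1 else -1)"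

definition thr_U :: "real \<Rightarrow> real \<Rightarrow> real \<Rightarrow> real" where
  "thr_U q tol \<epsilon> = q + tol - \<epsilon>"

definition thr_D :: "real \<Rightarrow> real \<Rightarrow> real \<Rightarrow> real" where
  "thr_D q tol \<epsilon> = q - tol + \<epsilon>"

text \<open>Pairs of a tolerance level \<open>\<epsilon> \<in> E\<close> whose two subroutines have both stopped by time \<open>r\<close> with
  equal decisions, and that common decision.\<close>
definition agreeing ::
  "nat \<Rightarrow> nat \<Rightarrow> real \<Rightarrow> real \<Rightarrow> real \<Rightarrow> real set \<Rightarrow> (nat \<Rightarrow> real) \<Rightarrow> nat \<Rightarrow> (real \<times> int) set" where
  "agreeing c n0 \<eta> q tol E x r = {(\<epsilon>, z). \<epsilon> \<in> E \<and>
     sub_stop c n0 \<eta> \<epsilon> (thr_U q tol \<epsilon>) x \<le> r \<and> sub_stop c n0 \<eta> \<epsilon> (thr_D q tol \<epsilon>) x \<le> r \<and>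
     sub_decision c n0 \<eta> \<epsilon> (thr_U q tol \<epsilon>) x = z \<and> sub_decision c n0 \<eta> \<epsilon> (thr_D q tol \<epsilon>) x = z}"

text \<open>The two subroutines coincide for \<open>\<epsilon> = tol\<close>, so for \<open>tol \<in> E\<close> the minimum exists.\<close>
definition izr_stop ::
  "nat \<Rightarrow> nat \<Rightarrow> real \<Rightarrow> real \<Rightarrow> real \<Rightarrow> real set \<Rightarrow> (nat \<Rightarrow> real) \<Rightarrow> nat" where
  "izr_stop c n0 \<eta> q tol E x = (LEAST r. agreeing c n0 \<eta> q tol E x r \<noteq> {})"

text \<open>A deterministic tie-breaking rule selects one of the levels that qualify at the stopping
  time; it may look at the time, at the qualifying levels and at their decisions.\<close>
definition tie_rule :: "(nat \<Rightarrow> (real \<times> int) set \<Rightarrow> real \<times> int) \<Rightarrow> bool" where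
  "tie_rule sel \<longleftrightarrow> (\<forall>r C. C \<noteq> {} \<longrightarrow> sel r C \<in> C)"

text \<open>The selected level and the declared decision.\<close>
definition izr_outcome ::
  "nat \<Rightarrow> nat \<Rightarrow> real \<Rightarrow> real \<Rightarrow> real \<Rightarrow> real set \<Rightarrow> (nat \<Rightarrow> (real \<times> int) set \<Rightarrow> real \<times> int) \<Rightarrow>
   (nat \<Rightarrow> real) \<Rightarrow> real \<times> int" where
  "izr_outcome c n0 \<eta> q tol E sel x =
     (let r = izr_stop c n0 \<eta> q tol E x in sel r (agreeing c n0 \<eta> q tol E x r))"

definition izr_decision ::
  "nat \<Rightarrow> nat \<Rightarrow> real \<Rightarrow> real \<Rightarrow> real \<Rightarrow> real set \<Rightarrow> (nat \<Rightarrow> (real \<times> int) set \<Rightarrow> real \<times> int) \<Rightarrow>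
   (nat \<Rightarrow> real) \<Rightarrow> int" where
  "izr_decision c n0 \<eta> q tol E sel x = snd (izr_outcome c n0 \<eta> q tol E sel x)"

definition correct_decision ::
  "'w measure \<Rightarrow> real \<Rightarrow> real \<Rightarrow> real \<Rightarrow> ('w \<Rightarrow> int) \<Rightarrow> 'w set" where
  "correct_decision M y q tol Z =
     (if y \<le> q - tol then {\<omega> \<in> space M. Z \<omega> = 1}
      else if y \<ge> q + tol then {\<omega> \<in> space M. Z \<omega> = -1}
      else space M)"

text \<open>The event that the procedure, run with levels \<open>lev l 1, \<dots>, lev l (T l)\<close> for each
  constraint \<open>l\<close>, decides constraint \<open>l\<close> of system \<open>i\<close> correctly.\<close>
definition CD ::
  "'w measure \<Rightarrow> ('k \<Rightarrow> nat \<Rightarrow> 'w \<Rightarrow> real ^ 's) \<Rightarrow> ('k \<Rightarrow> real ^ 's) \<Rightarrow> nat \<Rightarrow> nat \<Rightarrow> real \<Rightarrow>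
   ('s \<Rightarrow> real) \<Rightarrow> ('s \<Rightarrow> real) \<Rightarrow> ('s \<Rightarrow> nat) \<Rightarrow> ('s \<Rightarrow> nat \<Rightarrow> real) \<Rightarrow>
   ('k \<Rightarrow> 's \<Rightarrow> nat \<Rightarrow> (real \<times> int) set \<Rightarrow> real \<times> int) \<Rightarrow> 'k \<Rightarrow> 's \<Rightarrow> 'w set" where
  "CD M Y y c n0 \<eta> q tol T lev sel i l =
     correct_decision M (y i $ l) (q l) (tol l)
       (\<lambda>\<omega>. izr_decision c n0 \<eta> (q l) (tol l) (lev l ` {1..T l}) (sel i l) (\<lambda>j. Y i j \<omega> $ l))"

end

theory Submission
  imports Defs
begin

text \<open>
  By Bonferroni (and independence over the systems) it suffices that a single subroutine whose true
  drift is at least \<open>\<epsilon>\<close> away from its threshold decides wrongly with probability at most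
  \<open>g\<^sub>n(\<eta>)\<close>, where \<open>n = n\<^sub>0 - 1\<close>. By monotonicity the drift may be taken exactly \<open>\<epsilon>\<close>. Since the sample
  variance is independent of the partial sums from time \<open>n\<^sub>0\<close> on, one may condition on it; then the
  boundary is a fixed triangle, and the chi-squared Laplace transform turns \<open>exp (- t \<chi>\<^sup>2)\<close>
  into \<open>(1 + 2 t)\<^sup>-\<^sup>n\<^sup>/\<^sup>2\<close>, so that the conditional bound \<open>triangle_error\<close> becomes \<open>g\<^sub>n\<close>.

  For a fixed triangle no embedding into Brownian motion is needed. Adding the error probabilities
  under the two opposite drifts and changing measure to the driftless walk gives a cost of
  \<open>exp (c\<^sup>2 u - c \<bar>x\<bar>)\<close> for stopping at position \<open>x\<close> when the triangle has half-width \<open>u\<close>. The series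
  \<open>tri_series\<close>, obtained by repeated reflection at the two sides, solves the heat equation, equals this
  cost on the sides, and dominates it beyond them because the reflected terms form an
  alternating increasing sum. Backward induction along the walk then bounds the total cost by the value
  of the series at the starting point.
\<close>

subsection \<open>The alternating exponential series and Gaussian integrals\<close>

text \<open>The term of largest index enters with sign +. The induction also carries the upper bound
  \<open>b (n - 1)\<close>: the new term \<open>b n\<close> minus a value between 0 and
  \<open>b (n - 1)\<close> lies between 0 and \<open>b n\<close>.\<close>

lemma alternating_sum_nonneg:
  fixes b :: "nat \<Rightarrow> real"
  assumes b: "\<And>j. 0 \<le> b j" and mono: "\<And>j. b j \<le> b (Suc j)"
  shows "0 \<le> (\<Sum>j<n. (-1) ^ (n + 1 + j) * b j)"
proof -
  have "0 \<le> (\<Sum>j<n. (-1) ^ (n + 1 + j) * b j) \<and> (\<Sum>j<n. (-1) ^ (n + 1 + j) * b j) \<le> b (n - 1)"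
  proof (induction n)
    case 0
    then show ?case using b by simp
  next
    case (Suc n)
    have "(\<Sum>j<Suc n. (-1) ^ (Suc n + 1 + j) * b j) = b n - (\<Sum>j<n. (-1) ^ (n + 1 + j) * b j)"
      by (simp add: sum_negf)
    moreover have "b (n - 1) \<le> b n"
      using mono[of "n - 1"] by (cases n) auto
    ultimately show ?case using Suc by auto
  qed
  then show ?thesis ..
qed

text \<open>With k = m - c running from -(c-1) to c-1, each summand exp (k^2 u + k x) is preserved
  by a centred Gaussian step that lowers u by half its variance. The reflection k -> -k-1 pairs
  terms that coincide on the side x = u. The only partner missing from the sum, k = -c, is minus the
  stopping cost exp (c^2 u - c x).\<close>

definition tri_series :: "nat \<Rightarrow> real \<Rightarrow> real \<Rightarrow> real" where
  "tri_series c u x =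
     (\<Sum>m=1..<2*c. (-1) ^ (m + 1) * exp ((real m - real c)\<^sup>2 * u + (real m - real c) * x))"

lemma tri_series_minus: "tri_series c u (- x) = tri_series c u x"
  unfolding tri_series_def
proof (rule sum.reindex_bij_witness[where i = "\<lambda>m. 2 * c - m" and j = "\<lambda>m. 2 * c - m"])
  fix m assume m: "m \<in> {1..<2 * c}"
  have "even (2 * c - m) = even m" using m by (auto simp: even_diff_nat)
  then have "(-1::real) ^ (2 * c - m + 1) = (-1) ^ (m + 1)"
    by (cases "even m") auto
  moreover have r: "real (2 * c - m) - real c = - (real m - real c)" using m by (auto simp: of_nat_diff)
  ultimately show "(-1) ^ (2 * c - m + 1) * exp ((real (2 * c - m) - real c)\<^sup>2 * u + (real (2 * c - m) - real c) * x) =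
         (-1) ^ (m + 1) * exp ((real m - real c)\<^sup>2 * u + (real m - real c) * (- x))"
    by (simp only: r power2_minus mult_minus_left mult_minus_right)
qed auto

text \<open>Subtracting the cost completes the series with its term m = 0. The 2c terms then fall
  into reflected pairs, whose differences \<open>p j - q j\<close> vanish at x = u and, for x >= u,
  are nonnegative and increasing in j.\<close>

lemma tri_series_ge:
  assumes c: "1 \<le> c" and u: "0 \<le> u" and x: "u \<le> x"
  shows "exp ((real c)\<^sup>2 * u - real c * x) \<le> tri_series c u x"
proof -
  define e where "e m = (-1) ^ (m + 1) * exp ((real m - real c)\<^sup>2 * u + (real m - real c) * x)" for m
  define p where "p j = exp ((real j)\<^sup>2 * u + real j * x)" for j :: nat
  define q where "q j = exp ((real j + 1)\<^sup>2 * u - (real j + 1) * x)" for j :: nat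
  have "{..<2 * c} = insert 0 {1..<2 * c}" using c by auto
  then have 1: "(\<Sum>m<2 * c. e m) = tri_series c u x - exp ((real c)\<^sup>2 * u - real c * x)"
    by (simp add: tri_series_def e_def)
  have "(\<Sum>m<2 * c. e m) = (\<Sum>m<c. e m) + (\<Sum>m=c..<2*c. e m)"
    by (simp add: lessThan_atLeast0 sum.atLeastLessThan_concat)
  also have "(\<Sum>m<c. e m) = (\<Sum>j<c. e (c - Suc j))"
    by (simp add: sum.nat_diff_reindex)
  also have "(\<Sum>m=c..<2*c. e m) = (\<Sum>j<c. e (c + j))"
    using sum.shift_bounds_nat_ivl[of e 0 c c] by (simp add: lessThan_atLeast0 add.commute mult_2)
  \<comment> \<open>Indices c + j and c - 1 - j are reflections of each other at the side x = u and
    carry opposite signs.\<close>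
  also have "(\<Sum>j<c. e (c - Suc j)) + (\<Sum>j<c. e (c + j)) = (\<Sum>j<c. (-1) ^ (c + 1 + j) * (p j - q j))"
    unfolding sum.distrib[symmetric]
  proof (rule sum.cong[OF refl])
    fix j assume j: "j \<in> {..<c}"
    have 1: "(-1::real) ^ (c - Suc j + 1) = - ((-1) ^ (c + 1 + j))"
    proof -
      obtain d where d: "c = Suc j + d" using j by (metis less_iff_Suc_add lessThan_iff add_Suc)
      show ?thesis unfolding d by (simp add: power_add flip: power_mult_distrib)
    qed
    have 2: "real (c - Suc j) - real c = - (real j + 1)" using j by (auto simp: of_nat_diff)
    have 3: "e (c - Suc j) = - ((-1) ^ (c + 1 + j)) * q j"
      unfolding e_def 1 2 q_def power2_minus by (simp add: algebra_simps)
    have 4: "e (c + j) = (-1) ^ (c + 1 + j) * p j"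
      by (simp add: e_def p_def algebra_simps)
    show "e (c - Suc j) + e (c + j) = (-1) ^ (c + 1 + j) * (p j - q j)"
      unfolding 3 4 by (simp add: algebra_simps)
  qed
  also have "\<dots> \<ge> 0"
  proof (rule alternating_sum_nonneg)
    \<comment> \<open>Both factors are nonnegative and increase with j: the first because u >= 0,
      the second because x >= u.\<close>
    have pq: "p j - q j = exp (real j * (real j + 1) * u) * (exp (real j * (x - u)) - exp (- (real j + 1) * (x - u)))" for j
      unfolding p_def q_def
      by (simp add: right_diff_distrib flip: exp_add) (simp add: power2_eq_square algebra_simps)
    have nn: "0 \<le> exp (real j * (x - u)) - exp (- (real j + 1) * (x - u))" for j
    proof -
      have "- (real j + 1) * (x - u) \<le> 0" "0 \<le> real j * (x - u)"
        using x by (auto intro: mult_nonpos_nonneg)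
      then show ?thesis by simp
    qed
    show "0 \<le> p j - q j" for j
      unfolding pq using nn by simp
    show "p j - q j \<le> p (Suc j) - q (Suc j)" for j
      unfolding pq
    proof (intro mult_mono nn)
      show "exp (real j * (real j + 1) * u) \<le> exp (real (Suc j) * (real (Suc j) + 1) * u)"
        using u by (auto intro!: mult_right_mono mult_mono)
      have "real j * (x - u) \<le> real (Suc j) * (x - u)"
        "- (real (Suc j) + 1) * (x - u) \<le> - (real j + 1) * (x - u)"
        using x by (intro mult_right_mono; simp)+
      then have "exp (real j * (x - u)) \<le> exp (real (Suc j) * (x - u))"
         "exp (- (real (Suc j) + 1) * (x - u)) \<le> exp (- (real j + 1) * (x - u))" by (simp_all del: of_nat_Suc)
      then show "exp (real j * (x - u)) - exp (- (real j + 1) * (x - u))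
          \<le> exp (real (Suc j) * (x - u)) - exp (- (real (Suc j) + 1) * (x - u))"
        by linarith
    qed simp
  qed
  finally show ?thesis using 1 by simp
qed

lemma tri_series_ge_abs:
  assumes "1 \<le> c" "0 \<le> u" "u \<le> \<bar>x\<bar>"
  shows "exp ((real c)\<^sup>2 * u - real c * \<bar>x\<bar>) \<le> tri_series c u x"
  using tri_series_ge[OF assms] tri_series_minus[of c u x] by (cases "x \<ge> 0") auto

section \<open>Integrals against the standard normal distribution\<close>

abbreviation "\<N> \<equiv> std_normal_distribution"

interpretation std_normal: prob_space "\<N>"
  using real_dist_normal_dist by (simp add: real_distribution_def)

text \<open>The Cameron-Martin formula in one dimension; it trades the drift of a step for an
  exponential weight.\<close>

lemma std_normal_integral_shift:
  fixes f :: "real \<Rightarrow> real"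
  assumes [measurable]: "f \<in> borel_measurable borel"
  shows "(\<integral>z. f (z + a) \<partial>\<N>) = (\<integral>z. f z * exp (a * z - a\<^sup>2 / 2) \<partial>\<N>)"
proof -
  have "(\<integral>z. f (z + a) \<partial>\<N>) = (\<integral>z. std_normal_density z * f (z + a) \<partial>lborel)"
    by (simp add: integral_density)
  also have "\<dots> = (\<integral>z. std_normal_density (z - a) * f z \<partial>lborel)"
    using lborel_integral_real_affine[of 1 "\<lambda>z. std_normal_density (z - a) * f z" a]
    by (simp add: add.commute)
  also have "\<dots> = (\<integral>z. std_normal_density z * (f z * exp (a * z - a\<^sup>2 / 2)) \<partial>lborel)"
    by (intro Bochner_Integration.integral_cong)
       (auto simp: std_normal_density_def power2_eq_square field_simps simp flip: exp_add)
  also have "\<dots> = (\<integral>z. f z * exp (a * z - a\<^sup>2 / 2) \<partial>\<N>)"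
    by (simp add: integral_density)
  finally show ?thesis .
qed

lemma std_normal_integral_minus:
  fixes f :: "real \<Rightarrow> real"
  assumes [measurable]: "f \<in> borel_measurable borel"
  shows "(\<integral>z. f (- z) \<partial>\<N>) = (\<integral>z. f z \<partial>\<N>)"
  using lborel_integral_real_affine[of "-1" "\<lambda>z. std_normal_density z * f z" 0]
  by (simp add: integral_density std_normal_density_def)

lemma std_normal_exp:
  shows integrable_std_normal_exp: "integrable \<N> (\<lambda>z. exp (a * z + b))"
    and integral_std_normal_exp: "(\<integral>z. exp (a * z + b) \<partial>\<N>) = exp (a\<^sup>2 / 2 + b)"
proof -
  have eq: "std_normal_density z * exp (a * z + b) = exp (a\<^sup>2 / 2 + b) * normal_density a 1 z" for z
    by (auto simp: std_normal_density_def normal_density_def power2_eq_square field_simps simp flip: exp_add)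
  show "integrable \<N> (\<lambda>z. exp (a * z + b))"
    by (subst integrable_density) (auto simp: eq)
  show "(\<integral>z. exp (a * z + b) \<partial>\<N>) = exp (a\<^sup>2 / 2 + b)"
    by (subst integral_density) (auto simp: eq)
qed

text \<open>The map (x, y) -> (a x + b y, b x - a y) is orthogonal. It is carried out as two
  one-dimensional affine substitutions, first in x with y fixed and then in y, whose Jacobians 1/a
  and a cancel; hence the condition a > 0.\<close>

lemma std_normal_rotation:
  fixes f :: "real \<Rightarrow> real \<Rightarrow> ennreal"
  assumes [measurable]: "(\<lambda>(x, y). f x y) \<in> borel_measurable (borel \<Otimes>\<^sub>M borel)"
    and ab: "a\<^sup>2 + b\<^sup>2 = 1" "a > 0"
  shows "(\<integral>\<^sup>+x. \<integral>\<^sup>+y. f (a * x + b * y) (b * x - a * y) \<partial>\<N> \<partial>\<N>) = (\<integral>\<^sup>+x. \<integral>\<^sup>+y. f x y \<partial>\<N> \<partial>\<N>)"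
proof -
  let ?p = "\<lambda>x y. ennreal (std_normal_density x) * ennreal (std_normal_density y)"
  have [measurable]: "case_prod f \<in> borel_measurable (borel \<Otimes>\<^sub>M borel)"
    using assms(1) by simp
  have density: "(\<integral>\<^sup>+x. \<integral>\<^sup>+y. g x y \<partial>\<N> \<partial>\<N>) = (\<integral>\<^sup>+x. \<integral>\<^sup>+y. ?p x y * g x y \<partial>lborel \<partial>lborel)"
    if [measurable]: "case_prod g \<in> borel_measurable (borel \<Otimes>\<^sub>M borel)" for g
    by (simp add: nn_integral_density nn_integral_cmult[symmetric] mult.assoc)
  \<comment> \<open>Invariance of the Euclidean norm, with the old x and the new y expressed through
    the mixed coordinates new x and old y.\<close>
  have p: "?p ((x - b * y) / a) y = ?p x ((y - b * x) / a)" for x y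
  proof -
    have "((x - b * y) / a)\<^sup>2 + y\<^sup>2 = x\<^sup>2 + ((y - b * x) / a)\<^sup>2"
    proof -
      have "(x - b * y)\<^sup>2 + a\<^sup>2 * y\<^sup>2 = a\<^sup>2 * x\<^sup>2 + (y - b * x)\<^sup>2"
      proof -
        have "x\<^sup>2 + (a\<^sup>2 + b\<^sup>2) * y\<^sup>2 = (a\<^sup>2 + b\<^sup>2) * x\<^sup>2 + y\<^sup>2" using ab by simp
        then show ?thesis unfolding power2_diff power_mult_distrib by (simp add: algebra_simps)
      qed
      then show ?thesis using ab by (simp add: power_divide field_simps)
    qed
    then have "std_normal_density ((x - b * y) / a) * std_normal_density y
        = std_normal_density x * std_normal_density ((y - b * x) / a)"
      by (simp add: std_normal_density_def field_simps flip: exp_add)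
    then show ?thesis by (simp flip: ennreal_mult)
  qed
  have "(\<integral>\<^sup>+x. \<integral>\<^sup>+y. f (a * x + b * y) (b * x - a * y) \<partial>\<N> \<partial>\<N>)
      = (\<integral>\<^sup>+x. \<integral>\<^sup>+y. ?p x y * f (a * x + b * y) (b * x - a * y) \<partial>lborel \<partial>lborel)"
    by (rule density) measurable
  also have "\<dots> = (\<integral>\<^sup>+y. \<integral>\<^sup>+x. ?p x y * f (a * x + b * y) (b * x - a * y) \<partial>lborel \<partial>lborel)"
    by (rule lborel_pair.Fubini'[symmetric]) measurable
  also have "\<dots> = (\<integral>\<^sup>+y. ennreal (1 / a) * (\<integral>\<^sup>+x. ?p ((x - b * y) / a) y * f x ((b * x - y) / a) \<partial>lborel) \<partial>lborel)"
  proof (rule nn_integral_cong)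
    fix y :: real
    have "(\<integral>\<^sup>+x. ?p x y * f (a * x + b * y) (b * x - a * y) \<partial>lborel)
       = ennreal \<bar>1 / a\<bar> * (\<integral>\<^sup>+x. ?p (- b * y / a + 1 / a * x) y * f (a * (- b * y / a + 1 / a * x) + b * y) (b * (- b * y / a + 1 / a * x) - a * y) \<partial>lborel)"
      using ab by (intro nn_integral_real_affine) (auto, measurable)
    also have "(\<lambda>x. - b * y / a + 1 / a * x) = (\<lambda>x. (x - b * y) / a)"
      using ab by (auto simp: field_simps)
    then have "(\<integral>\<^sup>+x. ?p (- b * y / a + 1 / a * x) y * f (a * (- b * y / a + 1 / a * x) + b * y) (b * (- b * y / a + 1 / a * x) - a * y) \<partial>lborel)
      = (\<integral>\<^sup>+x. ?p ((x - b * y) / a) y * f (a * ((x - b * y) / a) + b * y) (b * ((x - b * y) / a) - a * y) \<partial>lborel)"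
      by metis
    also have "\<dots> = (\<integral>\<^sup>+x. ?p ((x - b * y) / a) y * f x ((b * x - y) / a) \<partial>lborel)"
    proof (intro nn_integral_cong)
      fix x
      have "b * ((x - b * y) / a) - a * y = (b * x - (b\<^sup>2 + a\<^sup>2) * y) / a"
        using ab(2) by (simp add: field_simps power2_eq_square)
      also have "\<dots> = (b * x - y) / a" using ab(1) by (simp add: add.commute)
      finally show "?p ((x - b * y) / a) y * f (a * ((x - b * y) / a) + b * y) (b * ((x - b * y) / a) - a * y)
        = ?p ((x - b * y) / a) y * f x ((b * x - y) / a)"
        using ab(2) by simp
    qed
    finally show "(\<integral>\<^sup>+x. ?p x y * f (a * x + b * y) (b * x - a * y) \<partial>lborel)
       = ennreal (1 / a) * (\<integral>\<^sup>+x. ?p ((x - b * y) / a) y * f x ((b * x - y) / a) \<partial>lborel)"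
      using ab(2) by simp
  qed
  also have "\<dots> = (\<integral>\<^sup>+y. \<integral>\<^sup>+x. ennreal (1 / a) * (?p ((x - b * y) / a) y * f x ((b * x - y) / a)) \<partial>lborel \<partial>lborel)"
    by (subst nn_integral_cmult) auto
  also have "\<dots> = (\<integral>\<^sup>+x. \<integral>\<^sup>+y. ennreal (1 / a) * (?p ((x - b * y) / a) y * f x ((b * x - y) / a)) \<partial>lborel \<partial>lborel)"
    by (rule lborel_pair.Fubini') measurable
  also have "\<dots> = (\<integral>\<^sup>+x. \<integral>\<^sup>+y. ?p x y * f x y \<partial>lborel \<partial>lborel)"
  proof (rule nn_integral_cong)
    fix x :: real
    have "(\<integral>\<^sup>+y. ennreal (1 / a) * (?p ((x - b * y) / a) y * f x ((b * x - y) / a)) \<partial>lborel)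
      = (\<integral>\<^sup>+y. ennreal (1 / a) * (?p x ((y - b * x) / a) * f x ((b * x - y) / a)) \<partial>lborel)"
      unfolding p ..
    also have "\<dots> = ennreal \<bar>a\<bar> * (\<integral>\<^sup>+y. ennreal (1 / a) * (?p x (((b * x + - a * y) - b * x) / a) * f x ((b * x - (b * x + - a * y)) / a)) \<partial>lborel)"
      using ab(2) nn_integral_real_affine[of "\<lambda>y. ennreal (1 / a) * (?p x ((y - b * x) / a) * f x ((b * x - y) / a))" "- a" "b * x"]
      by simp
    also have "\<dots> = (\<integral>\<^sup>+y. ennreal \<bar>a\<bar> * (ennreal (1 / a) * (?p x (((b * x + - a * y) - b * x) / a) * f x ((b * x - (b * x + - a * y)) / a))) \<partial>lborel)"
      by (rule nn_integral_cmult[symmetric]) measurable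
    also have "\<dots> = (\<integral>\<^sup>+y. ?p x y * f x y \<partial>lborel)"
    proof (intro nn_integral_cong)
      fix y
      have "((b * x + - a * y) - b * x) / a = - y" "(b * x - (b * x + - a * y)) / a = y"
        using ab(2) by (auto simp: field_simps)
      moreover have "ennreal \<bar>a\<bar> * ennreal (1 / a) = 1" using ab(2) by (simp flip: ennreal_mult)
      ultimately show "ennreal \<bar>a\<bar> * (ennreal (1 / a) * (?p x (((b * x + - a * y) - b * x) / a) * f x ((b * x - (b * x + - a * y)) / a)))
        = ?p x y * f x y"
        by (simp add: std_normal_density_def flip: mult.assoc)
    qed
    finally show "(\<integral>\<^sup>+y. ennreal (1 / a) * (?p ((x - b * y) / a) y * f x ((b * x - y) / a)) \<partial>lborel) = (\<integral>\<^sup>+y. ?p x y * f x y \<partial>lborel)" .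
  qed
  also have "\<dots> = (\<integral>\<^sup>+x. \<integral>\<^sup>+y. f x y \<partial>\<N> \<partial>\<N>)"
    by (rule density[symmetric]) measurable
  finally show ?thesis .
qed

text \<open>A Gaussian step of variance \<tau>^2 is the sum of independent steps of variances s^2
  and t^2: rotate the pair of variables, the integrand before rotation being constant in the second
  one.\<close>

lemma std_normal_split:
  fixes f :: "real \<Rightarrow> ennreal"
  assumes [measurable]: "f \<in> borel_measurable borel"
    and t: "\<tau>\<^sup>2 = s\<^sup>2 + t\<^sup>2" "s > 0" "\<tau> > 0"
  shows "(\<integral>\<^sup>+x. f (\<tau> * x) \<partial>\<N>) = (\<integral>\<^sup>+x. \<integral>\<^sup>+y. f (s * x + t * y) \<partial>\<N> \<partial>\<N>)"
proof -
  have "(s / \<tau>)\<^sup>2 + (t / \<tau>)\<^sup>2 = 1"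
    using t by (simp add: power_divide flip: add_divide_distrib)
  then have "(\<integral>\<^sup>+x. \<integral>\<^sup>+y. f (\<tau> * (s / \<tau> * x + t / \<tau> * y)) \<partial>\<N> \<partial>\<N>) = (\<integral>\<^sup>+x. \<integral>\<^sup>+y. f (\<tau> * x) \<partial>\<N> \<partial>\<N>)"
    using t by (intro std_normal_rotation[where f = "\<lambda>x y. f (\<tau> * x)"]) (auto, measurable)
  moreover have "\<tau> * (s / \<tau> * x + t / \<tau> * y) = s * x + t * y" for x y
    using t by (simp add: field_simps)
  ultimately show ?thesis by (simp add: std_normal.emeasure_space_1[simplified])
qed

subsection \<open>Leaving a triangle through the wrong side\<close>

text \<open>Each exponential is integrated in closed form: the gain (k \<tau>)^2 / 2 from the
  Gaussian mean offsets the loss in k^2 u.\<close>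

lemma tri_series_heat:
  shows integrable_tri_series: "integrable \<N> (\<lambda>z. tri_series c (u - \<tau>\<^sup>2 / 2) (x + \<tau> * z))"
    and integral_tri_series: "(\<integral>z. tri_series c (u - \<tau>\<^sup>2 / 2) (x + \<tau> * z) \<partial>\<N>) = tri_series c u x"
proof -
  have eq: "k\<^sup>2 * (u - \<tau>\<^sup>2 / 2) + k * (x + \<tau> * z) = (k * \<tau>) * z + (k\<^sup>2 * (u - \<tau>\<^sup>2 / 2) + k * x)"
    "(k * \<tau>)\<^sup>2 / 2 + (k\<^sup>2 * (u - \<tau>\<^sup>2 / 2) + k * x) = k\<^sup>2 * u + k * x" for k z :: real
    by (simp_all add: power_mult_distrib field_simps)
  show "integrable \<N> (\<lambda>z. tri_series c (u - \<tau>\<^sup>2 / 2) (x + \<tau> * z))"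
    unfolding tri_series_def eq(1)
    by (intro Bochner_Integration.integrable_sum integrable_mult_right integrable_std_normal_exp)
  show "(\<integral>z. tri_series c (u - \<tau>\<^sup>2 / 2) (x + \<tau> * z) \<partial>\<N>) = tri_series c u x"
    unfolding tri_series_def eq(1)
    by (subst Bochner_Integration.integral_sum)
       (simp_all only: integral_std_normal_exp eq(2) integral_mult_right_zero
          integrable_mult_right[OF integrable_std_normal_exp])
qed

text \<open>At half-width 0 every point lies on or beyond the sides, where the series dominates an
  exponential. For general u, one Gaussian step of variance 2 u leads to half-width 0.\<close>

lemma tri_series_nonneg:
  assumes "1 \<le> c" "0 \<le> u"
  shows "0 \<le> tri_series c u x"
proof -
  have "0 \<le> tri_series c 0 w" for w
    using order_trans[OF exp_ge_zero tri_series_ge_abs[of c 0 w]] assms by simp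
  then have "0 \<le> (\<integral>z. tri_series c (u - (sqrt (2 * u))\<^sup>2 / 2) (x + sqrt (2 * u) * z) \<partial>\<N>)"
    using assms by (intro integral_nonneg_AE) simp
  then show ?thesis unfolding integral_tri_series .
qed

text \<open>Probability that a random walk with increments \<open>N(- c \<theta>\<^sup>2, \<theta>\<^sup>2)\<close> started at \<open>x\<close>
  first leaves a triangle, currently of half-width \<open>u\<close> and shrinking by \<open>\<theta>\<^sup>2 / 2\<close> per step, through its
  upper side, and does so within the first \<open>k\<close> inspections. A tie \<open>x = 0\<close> past the apex counts as a
  lower exit, so that upper exits of a path and of its reflection are disjoint.\<close>
fun up_prob :: "nat \<Rightarrow> real \<Rightarrow> nat \<Rightarrow> real \<Rightarrow> real \<Rightarrow> real" where
  "up_prob c \<theta> 0 u x = 0"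
| "up_prob c \<theta> (Suc k) u x =
     (if x \<le> - max 0 u then 0 else if x \<ge> max 0 u then 1
      else \<integral>z. up_prob c \<theta> k (u - \<theta>\<^sup>2 / 2) (x + \<theta> * z - real c * \<theta>\<^sup>2) \<partial>\<N>)"

lemma up_prob_measurable_pair: "(\<lambda>(u, x). up_prob c \<theta> k u x) \<in> borel_measurable (borel \<Otimes>\<^sub>M borel)"
proof (induction k)
  case (Suc k)
  note [measurable] = Suc.IH
  show ?case unfolding up_prob.simps by measurable
qed simp

lemma up_prob_measurable[measurable (raw)]:
  assumes "u \<in> borel_measurable M" "x \<in> borel_measurable M"
  shows "(\<lambda>w. up_prob c \<theta> k (u w) (x w)) \<in> borel_measurable M"
  using measurable_compose[OF measurable_Pair[OF assms] up_prob_measurable_pair] by simp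

lemma up_prob_nonneg: "0 \<le> up_prob c \<theta> k u x"
  by (induction k arbitrary: u x) (auto intro!: integral_nonneg_AE)

lemma up_prob_le_1: "up_prob c \<theta> k u x \<le> 1"
proof (induction k arbitrary: u x)
  case (Suc k)
  have "(\<integral>z. up_prob c \<theta> k (u - \<theta>\<^sup>2 / 2) (x + \<theta> * z - real c * \<theta>\<^sup>2) \<partial>\<N>) \<le> (\<integral>z. 1 \<partial>\<N>)"
    using Suc.IH by (intro integral_mono std_normal.integrable_const_bound[where B = 1])
      (auto simp: up_prob_nonneg)
  then show ?case by (simp add: std_normal.prob_space[simplified])
qed simp

text \<open>The error probability under the two opposite drifts, as seen from the driftless walk.\<close>
definition sym_cost :: "nat \<Rightarrow> (real \<Rightarrow> real) \<Rightarrow> real \<Rightarrow> real \<Rightarrow> real" where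
  "sym_cost c V u x = exp ((real c)\<^sup>2 * u) * (exp (- real c * x) * V x + exp (real c * x) * V (- x))"

text \<open>The change of measure: the weights exp (-c x) and exp (c x) absorb the drift -c \<tau>^2
  of the walks started at x and at -x, so that the cost is averaged over a driftless step.\<close>

lemma sym_cost_step:
  assumes [measurable]: "V \<in> borel_measurable borel" and V: "\<And>x. 0 \<le> V x" "\<And>x. V x \<le> 1"
  shows integrable_sym_cost: "integrable \<N> (\<lambda>z. sym_cost c V (u - \<tau>\<^sup>2 / 2) (x + \<tau> * z))"
    and integral_sym_cost: "(\<integral>z. sym_cost c V (u - \<tau>\<^sup>2 / 2) (x + \<tau> * z) \<partial>\<N>)
      = sym_cost c (\<lambda>x. \<integral>z. V (x + \<tau> * z - real c * \<tau>\<^sup>2) \<partial>\<N>) u x"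
proof -
  let ?a = "- (real c * \<tau>)"
  define A where "A z = V (x + \<tau> * z) * exp (?a * z - ?a\<^sup>2 / 2)" for z
  define B where "B z = V (- (x + \<tau> * z)) * exp (- ?a * z - ?a\<^sup>2 / 2)" for z
  have int: "integrable \<N> A" "integrable \<N> B"
  proof -
    show "integrable \<N> A"
    proof (rule Bochner_Integration.integrable_bound)
      show "integrable \<N> (\<lambda>z. exp (?a * z + (- ?a\<^sup>2 / 2)))" by (rule integrable_std_normal_exp)
      show "A \<in> borel_measurable \<N>" unfolding A_def by measurable
      show "AE z in \<N>. norm (A z) \<le> norm (exp (?a * z + (- ?a\<^sup>2 / 2)))"
        using V by (auto simp: A_def abs_mult intro!: mult_left_le_one_le)
    qed
    show "integrable \<N> B"
    proof (rule Bochner_Integration.integrable_bound)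
      show "integrable \<N> (\<lambda>z. exp (- ?a * z + (- ?a\<^sup>2 / 2)))" by (rule integrable_std_normal_exp)
      show "B \<in> borel_measurable \<N>" unfolding B_def by measurable
      show "AE z in \<N>. norm (B z) \<le> norm (exp (- ?a * z + (- ?a\<^sup>2 / 2)))"
        using V by (auto simp: B_def abs_mult intro!: mult_left_le_one_le)
    qed
  qed
  have A: "(\<integral>z. V (x + \<tau> * z - real c * \<tau>\<^sup>2) \<partial>\<N>) = (\<integral>z. A z \<partial>\<N>)"
    unfolding A_def
    by (subst std_normal_integral_shift[symmetric]) (auto simp: algebra_simps power2_eq_square)
  have "(\<integral>z. V (- x + \<tau> * z - real c * \<tau>\<^sup>2) \<partial>\<N>)
      = (\<integral>z. V (- x + \<tau> * z) * exp (?a * z - ?a\<^sup>2 / 2) \<partial>\<N>)"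
    by (subst std_normal_integral_shift[symmetric]) (auto simp: algebra_simps power2_eq_square)
  \<comment> \<open>The substitution z -> -z lets the two starting points x and -x share one
    driftless step.\<close>
  also have "\<dots> = (\<integral>z. V (- x + \<tau> * - z) * exp (?a * - z - ?a\<^sup>2 / 2) \<partial>\<N>)"
    by (rule std_normal_integral_minus[symmetric]) measurable
  also have "\<dots> = (\<integral>z. B z \<partial>\<N>)"
    by (intro Bochner_Integration.integral_cong) (auto simp: B_def)
  finally have B: "(\<integral>z. V (- x + \<tau> * z - real c * \<tau>\<^sup>2) \<partial>\<N>) = (\<integral>z. B z \<partial>\<N>)" .
  have eq: "sym_cost c V (u - \<tau>\<^sup>2 / 2) (x + \<tau> * z)
      = exp ((real c)\<^sup>2 * u) * (exp (- real c * x) * A z + exp (real c * x) * B z)" for z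
  proof -
    have "exp ((real c)\<^sup>2 * (u - \<tau>\<^sup>2 / 2)) * exp (- real c * (x + \<tau> * z))
        = exp ((real c)\<^sup>2 * u) * (exp (- real c * x) * exp (?a * z - ?a\<^sup>2 / 2))"
      "exp ((real c)\<^sup>2 * (u - \<tau>\<^sup>2 / 2)) * exp (real c * (x + \<tau> * z))
        = exp ((real c)\<^sup>2 * u) * (exp (real c * x) * exp (- ?a * z - ?a\<^sup>2 / 2))"
      unfolding exp_add[symmetric] by (simp_all add: algebra_simps power_mult_distrib)
    then show ?thesis
      unfolding sym_cost_def A_def B_def distrib_left mult.assoc[symmetric]
      by (simp add: mult.assoc mult.commute mult.left_commute)
  qed
  show "integrable \<N> (\<lambda>z. sym_cost c V (u - \<tau>\<^sup>2 / 2) (x + \<tau> * z))"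
    unfolding eq using int by simp
  show "(\<integral>z. sym_cost c V (u - \<tau>\<^sup>2 / 2) (x + \<tau> * z) \<partial>\<N>)
      = sym_cost c (\<lambda>x. \<integral>z. V (x + \<tau> * z - real c * \<tau>\<^sup>2) \<partial>\<N>) u x"
    unfolding eq unfolding sym_cost_def A B using int by simp
qed

text \<open>With \<sigma> the sign of x, the inequality |w| >= \<sigma> w dominates the integrand by
  an exponential whose Gaussian mean is exactly the right-hand side.\<close>

lemma exp_abs_supermartingale:
  "(\<integral>z. exp (- (c\<^sup>2 * t\<^sup>2 / 2) - c * \<bar>x + t * z\<bar>) \<partial>\<N>) \<le> exp (- c * \<bar>x\<bar>)" if c: "0 \<le> c"
proof -
  obtain \<sigma> :: real where \<sigma>: "\<sigma> = 1 \<or> \<sigma> = -1" "\<bar>x\<bar> = \<sigma> * x"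
    by (cases "0 \<le> x") (auto intro: that[of 1] that[of "-1"])
  have le: "exp (- (c\<^sup>2 * t\<^sup>2 / 2) - c * \<bar>x + t * z\<bar>) \<le> exp (- \<sigma> * c * t * z + (- (c\<^sup>2 * t\<^sup>2 / 2) - c * \<bar>x\<bar>))" for z
  proof -
    have "\<sigma> * (x + t * z) \<le> \<bar>x + t * z\<bar>" using \<sigma>(1) by auto
    from mult_left_mono[OF this c] show ?thesis unfolding \<sigma>(2) by (simp add: algebra_simps)
  qed
  have "(\<integral>z. exp (- (c\<^sup>2 * t\<^sup>2 / 2) - c * \<bar>x + t * z\<bar>) \<partial>\<N>)
      \<le> (\<integral>z. exp (- \<sigma> * c * t * z + (- (c\<^sup>2 * t\<^sup>2 / 2) - c * \<bar>x\<bar>)) \<partial>\<N>)"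
  proof (rule integral_mono[OF _ integrable_std_normal_exp le])
    show "integrable \<N> (\<lambda>z. exp (- (c\<^sup>2 * t\<^sup>2 / 2) - c * \<bar>x + t * z\<bar>))"
      by (rule Bochner_Integration.integrable_bound[OF
            integrable_std_normal_exp[of "- \<sigma> * c * t" "- (c\<^sup>2 * t\<^sup>2 / 2) - c * \<bar>x\<bar>"]])
         (use le in auto)
  qed
  also have "\<dots> = exp (- c * \<bar>x\<bar>)"
    unfolding integral_std_normal_exp using \<sigma>(1) by (auto simp: power_mult_distrib)
  finally show ?thesis .
qed

text \<open>A step across the apex of the triangle is split into two Gaussian steps, the first of which ends
  exactly at the apex.\<close>
lemma apex_crossing:
  assumes c: "1 \<le> c" and u: "0 \<le> u" "u - \<tau>\<^sup>2 / 2 \<le> 0" and \<tau>: "0 < \<tau>"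
  shows "(\<integral>z. exp ((real c)\<^sup>2 * (u - \<tau>\<^sup>2 / 2) - real c * \<bar>x + \<tau> * z\<bar>) \<partial>\<N>) \<le> tri_series c u x"
proof -
  \<comment> \<open>2 u is the variance spent on reaching the apex, \<tau>^2 - 2 u the variance left
    for the step beyond it.\<close>
  define s t where "s = sqrt (2 * u)" and "t = sqrt (\<tau>\<^sup>2 - 2 * u)"
  have s: "s\<^sup>2 = 2 * u" and t: "t\<^sup>2 = \<tau>\<^sup>2 - 2 * u" using u by (auto simp: s_def t_def)
  have v: "(real c)\<^sup>2 * (u - \<tau>\<^sup>2 / 2) = - ((real c)\<^sup>2 * t\<^sup>2 / 2)"
    by (simp add: t field_simps)
  define h where "h w = exp (- ((real c)\<^sup>2 * t\<^sup>2 / 2) - real c * \<bar>w\<bar>)" for w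
  have [measurable]: "h \<in> borel_measurable borel" unfolding h_def by measurable
  have h_bound: "integrable \<N> (\<lambda>z. h (a + b * z))" for a b
    by (rule std_normal.integrable_const_bound[where B = 1])
       (auto simp: h_def intro!: AE_I2 intro: order_trans[of _ 0])
  have apex: "(\<integral>z. h (w + t * z) \<partial>\<N>) \<le> tri_series c 0 w" for w
    using exp_abs_supermartingale[of "real c" t w] tri_series_ge_abs[OF c, of 0 w]
    by (simp add: h_def)
  have nn: "ennreal (\<integral>z. h (a + b * z) \<partial>\<N>) = (\<integral>\<^sup>+z. h (a + b * z) \<partial>\<N>)" for a b
    by (rule nn_integral_eq_integral[symmetric, OF h_bound]) (auto simp: h_def)
  have "(\<integral>z. h (x + \<tau> * z) \<partial>\<N>) \<le> tri_series c u x"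
  proof (cases "u = 0")
    case True
    then have "\<tau> = t" using \<tau> by (simp add: t_def)
    then show ?thesis using apex True by simp
  next
    case False
    then have "s > 0" using u by (simp add: s_def)
    have "(\<integral>\<^sup>+z. h (x + \<tau> * z) \<partial>\<N>) = (\<integral>\<^sup>+z. \<integral>\<^sup>+z'. h (x + (s * z + t * z')) \<partial>\<N> \<partial>\<N>)"
      by (rule std_normal_split[of "\<lambda>w. ennreal (h (x + w))"]) (use \<tau> \<open>s > 0\<close> in \<open>auto simp: s t\<close>)
    also have "\<dots> = (\<integral>\<^sup>+z. ennreal (\<integral>z'. h ((x + s * z) + t * z') \<partial>\<N>) \<partial>\<N>)"
      unfolding nn by (simp add: add.assoc)
    also have "\<dots> \<le> (\<integral>\<^sup>+z. ennreal (tri_series c 0 (x + s * z)) \<partial>\<N>)"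
      by (intro nn_integral_mono ennreal_leI apex)
    also have "\<dots> = ennreal (\<integral>z. tri_series c 0 (x + s * z) \<partial>\<N>)"
      using integrable_tri_series[of c u s x] c
      by (intro nn_integral_eq_integral AE_I2 tri_series_nonneg) (auto simp: s)
    also have "(\<integral>z. tri_series c 0 (x + s * z) \<partial>\<N>) = tri_series c u x"
      using integral_tri_series[of c u s x] by (simp add: s)
    finally show ?thesis
      unfolding nn[symmetric] using tri_series_nonneg[OF c u(1)] by simp
  qed
  then show ?thesis unfolding v h_def .
qed

text \<open>Outside the triangle at most one of the walk and its reflection has left through the
  upper side; at x = 0 neither has, by the convention on ties in \<open>up_prob\<close>.\<close>

lemma sym_cost_outside:
  assumes "max 0 u \<le> \<bar>x\<bar>"
  shows "sym_cost c (up_prob c \<theta> k u) u x \<le> exp ((real c)\<^sup>2 * u - real c * \<bar>x\<bar>)"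
proof (cases k)
  case 0
  then show ?thesis by (simp add: sym_cost_def)
next
  case (Suc k')
  consider "x = 0" | "x > 0" | "x < 0" by linarith
  then show ?thesis
    using assms by cases (auto simp: Suc sym_cost_def exp_add[symmetric] simp flip: exp_add)
qed

text \<open>One backward step. If the new half-width is nonnegative, the heat equation for
  \<open>tri_series\<close> applies; otherwise the whole line lies outside the triangle after the
  step, and \<open>apex_crossing\<close> bounds the stopping cost. The step size \<tau> is separate
  from the later \<theta> because the first inspection comes after several observations at
  once.\<close>

lemma sym_cost_inside:
  assumes c: "1 \<le> c" and u: "0 \<le> u" and \<tau>: "0 < \<tau>"
    and V: "\<And>u x. 0 \<le> u \<Longrightarrow> sym_cost c (up_prob c \<theta> k u) u x \<le> tri_series c u x"
  shows "sym_cost c (\<lambda>x. \<integral>z. up_prob c \<theta> k (u - \<tau>\<^sup>2 / 2) (x + \<tau> * z - real c * \<tau>\<^sup>2) \<partial>\<N>) u x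
    \<le> tri_series c u x"
proof -
  let ?u = "u - \<tau>\<^sup>2 / 2"
  have int: "integrable \<N> (\<lambda>z. sym_cost c (up_prob c \<theta> k ?u) ?u (x + \<tau> * z))"
    by (rule integrable_sym_cost) (auto simp: up_prob_nonneg up_prob_le_1)
  have "(\<integral>z. sym_cost c (up_prob c \<theta> k ?u) ?u (x + \<tau> * z) \<partial>\<N>) \<le> tri_series c u x"
  proof (cases "0 \<le> ?u")
    case True
    then show ?thesis
      unfolding integral_tri_series[of c u \<tau> x, symmetric]
      by (intro integral_mono int integrable_tri_series V)
  next
    case False
    have "(\<integral>z. sym_cost c (up_prob c \<theta> k ?u) ?u (x + \<tau> * z) \<partial>\<N>)
        \<le> (\<integral>z. exp ((real c)\<^sup>2 * ?u - real c * \<bar>x + \<tau> * z\<bar>) \<partial>\<N>)"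
    proof (intro integral_mono int sym_cost_outside)
      show "integrable \<N> (\<lambda>z. exp ((real c)\<^sup>2 * ?u - real c * \<bar>x + \<tau> * z\<bar>))"
        by (rule std_normal.integrable_const_bound[where B = "exp ((real c)\<^sup>2 * ?u)"]) (auto intro!: AE_I2)
    qed (use False in auto)
    also have "\<dots> \<le> tri_series c u x"
      using False by (intro apex_crossing c u \<tau>) auto
    finally show ?thesis .
  qed
  then show ?thesis
    by (subst (asm) integral_sym_cost) (auto simp: up_prob_nonneg up_prob_le_1)
qed

lemma sym_cost_le_tri_series:
  assumes c: "1 \<le> c" and \<theta>: "0 < \<theta>"
  shows "0 \<le> u \<Longrightarrow> sym_cost c (up_prob c \<theta> k u) u x \<le> tri_series c u x"
proof (induction k arbitrary: u x)
  case 0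
  then show ?case using tri_series_nonneg[OF c] by (simp add: sym_cost_def)
next
  case (Suc k)
  show ?case
  proof (cases "u \<le> \<bar>x\<bar>")
    case True
    then have "max 0 u \<le> \<bar>x\<bar>" by simp
    then show ?thesis
      using sym_cost_outside tri_series_ge_abs[OF c Suc.prems True] order_trans by blast
  next
    case False
    then have "sym_cost c (up_prob c \<theta> (Suc k) u) u x
        = sym_cost c (\<lambda>x. \<integral>z. up_prob c \<theta> k (u - \<theta>\<^sup>2 / 2) (x + \<theta> * z - real c * \<theta>\<^sup>2) \<partial>\<N>) u x"
      by (auto simp: sym_cost_def)
    also have "\<dots> \<le> tri_series c u x"
      by (rule sym_cost_inside[OF c Suc.prems \<theta> Suc.IH])
    finally show ?thesis .
  qed
qed

text \<open>This is exp (-c^2 v) \<open>tri_series c v 0\<close> / 2: the terms m and 2c - m are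
  equal and merged, and the factor 1/2 falls on the unpaired middle term m = c. The coefficients are
  those of \<open>g_fun\<close>.\<close>

definition triangle_error :: "nat \<Rightarrow> real \<Rightarrow> real" where
  "triangle_error c v =
     (\<Sum>m=1..c. (-1) ^ (m + 1) * (1 - (1/2) * of_bool (m = c)) * exp (- ((2 * real c - real m) * real m * v)))"

lemma tri_series_0:
  assumes c: "1 \<le> c"
  shows "exp (- ((real c)\<^sup>2 * v)) * tri_series c v 0 = 2 * triangle_error c v"
proof -
  define e where "e m = (-1) ^ (m + 1) * exp (- ((2 * real c - real m) * real m * v))" for m
  have e: "exp (- ((real c)\<^sup>2 * v)) * ((-1) ^ (m + 1) * exp ((real m - real c)\<^sup>2 * v + (real m - real c) * 0)) = e m" for m
    unfolding e_def by (simp flip: exp_add) (simp add: power2_eq_square algebra_simps)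
  have refl: "(\<Sum>m=c+1..<2*c. e m) = (\<Sum>m=1..<c. e m)"
  proof (rule sum.reindex_bij_witness[where i = "\<lambda>m. 2 * c - m" and j = "\<lambda>m. 2 * c - m"])
    fix m assume m: "m \<in> {c+1..<2*c}"
    have "even (2 * c - m) = even m" using m by (auto simp: even_diff_nat)
    then have "(-1::real) ^ (2 * c - m + 1) = (-1) ^ (m + 1)"
      by (cases "even m") auto
    then show "e (2 * c - m) = e m"
      using m by (simp add: e_def of_nat_diff mult.commute)
  qed auto
  have "exp (- ((real c)\<^sup>2 * v)) * tri_series c v 0 = (\<Sum>m=1..<2*c. e m)"
    unfolding tri_series_def sum_distrib_left e ..
  also have "{1..<2*c} = {1..<c} \<union> {c} \<union> {c+1..<2*c}" using c by auto
  also have "sum e \<dots> = sum e {1..<c} + e c + sum e {c+1..<2*c}"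
    by (subst sum.union_disjoint; (subst sum.union_disjoint)?) auto
  also have "\<dots> = 2 * (sum e {1..<c} + e c / 2)"
    unfolding refl by simp
  also have "sum e {1..<c} + e c / 2 = triangle_error c v"
  proof -
    have "{1..c} = insert c {1..<c}" using c by auto
    then show ?thesis by (auto simp: triangle_error_def e_def intro!: sum.cong)
  qed
  finally show ?thesis .
qed

lemma triangle_error_nonneg:
  assumes "1 \<le> c" "0 \<le> v"
  shows "0 \<le> triangle_error c v"
  using tri_series_0[OF assms(1), of v] tri_series_nonneg[OF assms, of 0]
  by (smt (verit) exp_ge_zero mult_nonneg_nonneg)

text \<open>At x = 0 the walk and its reflection have the same error probability, so the symmetric
  cost is twice that probability times exp (c^2 v). The first step, of variance \<tau>^2, is taken
  before any inspection.\<close>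

lemma up_prob_start:
  assumes c: "1 \<le> c" and \<theta>: "0 < \<theta>" and \<tau>: "0 < \<tau>" and v: "0 \<le> v"
  shows "(\<integral>z. up_prob c \<theta> k (v - \<tau>\<^sup>2 / 2) (\<tau> * z - real c * \<tau>\<^sup>2) \<partial>\<N>) \<le> triangle_error c v"
proof -
  let ?I = "\<integral>z. up_prob c \<theta> k (v - \<tau>\<^sup>2 / 2) (\<tau> * z - real c * \<tau>\<^sup>2) \<partial>\<N>"
  have "exp ((real c)\<^sup>2 * v) * (2 * ?I) \<le> tri_series c v 0"
    using sym_cost_inside[OF c v \<tau> sym_cost_le_tri_series[OF c \<theta>], of k 0] by (simp add: sym_cost_def)
  then have "exp (- ((real c)\<^sup>2 * v)) * (exp ((real c)\<^sup>2 * v) * (2 * ?I)) \<le> 2 * triangle_error c v"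
    unfolding tri_series_0[OF c, symmetric] by (intro mult_left_mono) auto
  then show ?thesis
    by (simp flip: mult.assoc exp_add)
qed

subsection \<open>The sum and the squared deviations of a Gaussian sequence\<close>

definition std_normal_seq :: "(nat \<Rightarrow> real) measure" ("\<S>") where
  "\<S> = (\<Pi>\<^sub>M i\<in>UNIV. \<N>)"

interpretation iid: sequence_space "\<N>" ..

interpretation std_normal_seq: prob_space "\<S>"
  unfolding std_normal_seq_def by (rule iid.P.prob_space_axioms)

lemma space_std_normal_seq: "space \<S> = UNIV"
  by (auto simp: std_normal_seq_def space_PiM)

lemma std_normal_seq_component[measurable (raw)]: "(\<lambda>\<zeta>. \<zeta> i) \<in> borel_measurable \<S>"
  using measurable_component_singleton[of i UNIV "\<lambda>_. \<N>"] by (simp add: std_normal_seq_def)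

lemma measurable_std_normal_seqI:
  assumes "\<And>i. (\<lambda>w. f w i) \<in> borel_measurable M"
  shows "f \<in> measurable M \<S>"
  unfolding std_normal_seq_def
  by (rule measurable_PiM_single') (use assms in \<open>auto simp: space_PiM\<close>)

lemma measurable_compose3:
  assumes "(\<lambda>(x, y, z). f x y z) \<in> measurable (A \<Otimes>\<^sub>M B \<Otimes>\<^sub>M C) D"
    and "a \<in> measurable M A" "b \<in> measurable M B" "c \<in> measurable M C"
  shows "(\<lambda>w. f (a w) (b w) (c w)) \<in> measurable M D"
  using measurable_compose[OF measurable_Pair[OF assms(2) measurable_Pair[OF assms(3,4)]] assms(1)] by simp

definition seq_shift :: "nat \<Rightarrow> (nat \<Rightarrow> real) \<Rightarrow> nat \<Rightarrow> real" where
  "seq_shift n \<zeta> = (\<lambda>j. \<zeta> (j + n))"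

lemma seq_shift_simps[simp]:
  "seq_shift 0 \<zeta> = \<zeta>" "seq_shift (Suc n) (case_nat z \<zeta>) = seq_shift n \<zeta>"
  by (simp_all add: seq_shift_def)

lemma seq_shift_measurable[measurable]: "seq_shift n \<in> measurable \<S> \<S>"
  by (rule measurable_std_normal_seqI) (simp add: seq_shift_def)

lemma std_normal_seq_component'[measurable_dest]:
  assumes "f \<in> measurable N \<S>" "g \<in> measurable M N"
  shows "(\<lambda>w. f (g w) i) \<in> borel_measurable M"
  using measurable_compose[OF measurable_compose[OF assms(2,1)] std_normal_seq_component] .

lemma std_normal_seq_case_nat[measurable (raw)]:
  assumes [measurable]: "x \<in> borel_measurable M" "f \<in> measurable M \<S>"
  shows "(\<lambda>w. case_nat (x w) (f w)) \<in> measurable M \<S>"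
proof (rule measurable_std_normal_seqI)
  show "(\<lambda>w. case_nat (x w) (f w) i) \<in> borel_measurable M" for i
    by (cases i) auto
qed

lemma nn_integral_std_normal_seq_iter:
  assumes [measurable]: "f \<in> borel_measurable \<S>"
  shows "(\<integral>\<^sup>+\<zeta>. f \<zeta> \<partial>\<S>) = (\<integral>\<^sup>+z. \<integral>\<^sup>+\<zeta>. f (case_nat z \<zeta>) \<partial>\<S> \<partial>\<N>)"
proof -
  have "(\<integral>\<^sup>+\<zeta>. f \<zeta> \<partial>\<S>) = (\<integral>\<^sup>+\<zeta>. f \<zeta> \<partial>distr (\<N> \<Otimes>\<^sub>M \<S>) \<S> (\<lambda>(z, \<zeta>). case_nat z \<zeta>))"
    unfolding std_normal_seq_def by (simp only: iid.PiM_iter)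
  also have "\<dots> = (\<integral>\<^sup>+w. f (case w of (z, \<zeta>) \<Rightarrow> case_nat z \<zeta>) \<partial>(\<N> \<Otimes>\<^sub>M \<S>))"
    by (rule nn_integral_distr) measurable
  also have "\<dots> = (\<integral>\<^sup>+z. \<integral>\<^sup>+\<zeta>. f (case_nat z \<zeta>) \<partial>\<S> \<partial>\<N>)"
    by (subst std_normal_seq.nn_integral_fst[symmetric]) auto
  finally show ?thesis .
qed

definition sq_dev :: "nat \<Rightarrow> (nat \<Rightarrow> real) \<Rightarrow> real" where
  "sq_dev n \<zeta> = (\<Sum>j<n. (\<zeta> j - (\<Sum>j<n. \<zeta> j) / real n)\<^sup>2)"

lemma sq_dev_eq: "sq_dev n \<zeta> = (\<Sum>j<n. (\<zeta> j)\<^sup>2) - (\<Sum>j<n. \<zeta> j)\<^sup>2 / real n"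
proof (cases "n = 0")
  case False
  define p where "p = (\<Sum>j<n. \<zeta> j)"
  have "sq_dev n \<zeta> = (\<Sum>j<n. (\<zeta> j)\<^sup>2 - 2 * (p / n) * \<zeta> j + (p / n)\<^sup>2)"
    by (auto simp: sq_dev_def p_def power2_diff algebra_simps intro!: sum.cong)
  also have "\<dots> = (\<Sum>j<n. (\<zeta> j)\<^sup>2) - 2 * (p / n) * p + n * (p / n)\<^sup>2"
    unfolding sum.distrib sum_subtractf sum_distrib_left[symmetric] by (simp add: p_def)
  also have "\<dots> = (\<Sum>j<n. (\<zeta> j)\<^sup>2) - p\<^sup>2 / n"
    using False by (simp add: power2_eq_square field_simps)
  finally show ?thesis by (simp add: p_def)
qed (simp add: sq_dev_def)

text \<open>Welford's update: for independent standard normal entries, z minus the old mean has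
  variance (n + 1) / n, so the factor makes the added term the square of a standardized
  residual.\<close>

lemma sq_dev_case_nat:
  assumes "0 < n"
  shows "sq_dev (Suc n) (case_nat z \<zeta>)
    = sq_dev n \<zeta> + real n / real (Suc n) * (z - (\<Sum>j<n. \<zeta> j) / real n)\<^sup>2"
proof -
  define p where "p = (\<Sum>j<n. \<zeta> j)"
  have "z\<^sup>2 - (z + p)\<^sup>2 / real (Suc n) = - (p\<^sup>2 / real n) + real n / real (Suc n) * (z - p / real n)\<^sup>2"
  proof -
    have eq: "real (Suc n) = real n + 1" by simp
    have "real n + 1 \<noteq> 0" "real n \<noteq> 0" using assms by linarith+
    then show ?thesis unfolding eq
      by (simp add: divide_simps) (simp add: power2_eq_square algebra_simps)
  qed
  moreover have "sq_dev (Suc n) (case_nat z \<zeta>) = z\<^sup>2 + (\<Sum>j<n. (\<zeta> j)\<^sup>2) - (z + p)\<^sup>2 / real (Suc n)"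
    unfolding sq_dev_eq sum.lessThan_Suc_shift by (simp add: p_def)
  moreover have "sq_dev n \<zeta> = (\<Sum>j<n. (\<zeta> j)\<^sup>2) - p\<^sup>2 / real n"
    unfolding sq_dev_eq p_def ..
  ultimately show ?thesis by (simp add: p_def)
qed

lemma sq_dev_measurable[measurable]: "sq_dev n \<in> borel_measurable \<S>"
  unfolding sq_dev_def by measurable

text \<open>By induction on the sample size: the new observation and the standardized old sum are rotated into
  the standardized new sum and an independent residual, whose square is the increment of \<open>sq_dev\<close>.\<close>
lemma helmert:
  fixes f :: "real \<Rightarrow> real \<Rightarrow> (nat \<Rightarrow> real) \<Rightarrow> ennreal"
  assumes "(\<lambda>(s, q, \<zeta>). f s q \<zeta>) \<in> borel_measurable (borel \<Otimes>\<^sub>M borel \<Otimes>\<^sub>M \<S>)"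
  shows "(\<integral>\<^sup>+\<zeta>. f (\<Sum>j<Suc n. \<zeta> j) (sq_dev (Suc n) \<zeta>) (seq_shift (Suc n) \<zeta>) \<partial>\<S>)
    = (\<integral>\<^sup>+z. \<integral>\<^sup>+\<xi>. \<integral>\<^sup>+\<zeta>. f (sqrt (real (Suc n)) * z) (\<Sum>j<n. (\<xi> j)\<^sup>2) \<zeta> \<partial>\<S> \<partial>\<S> \<partial>\<N>)"
  using assms
proof (induction n arbitrary: f)
  case 0
  note [measurable (raw)] = measurable_compose3[OF 0]
  have "(\<integral>\<^sup>+\<zeta>. f (\<Sum>j<Suc 0. \<zeta> j) (sq_dev (Suc 0) \<zeta>) (seq_shift (Suc 0) \<zeta>) \<partial>\<S>)
      = (\<integral>\<^sup>+\<zeta>. f (\<zeta> 0) 0 (seq_shift (Suc 0) \<zeta>) \<partial>\<S>)"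
    by (simp add: sq_dev_def)
  also have "\<dots> = (\<integral>\<^sup>+z. \<integral>\<^sup>+\<zeta>. f z 0 \<zeta> \<partial>\<S> \<partial>\<N>)"
    by (subst nn_integral_std_normal_seq_iter) auto
  finally show ?case
    by (simp add: std_normal_seq.emeasure_space_1)
next
  case (Suc n)
  note [measurable (raw)] = measurable_compose3[OF Suc.prems]
  define m where "m = real (Suc n)"
  \<comment> \<open>For z the new observation and z' the standardized old sum, the new sum is sqrt
    (m + 1) (a z + b z'), and the square of b z - a z' is the increment of
    \<open>sq_dev\<close>.\<close>
  define a b where "a = 1 / sqrt (m + 1)" and "b = sqrt m / sqrt (m + 1)"
  have m: "0 < m" by (simp add: m_def)
  then have ab: "a\<^sup>2 + b\<^sup>2 = 1" "0 < a"
    by (auto simp: a_def b_def power_divide add_divide_distrib[symmetric])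
  \<comment> \<open>\<open>G\<close> integrates out the earlier residuals and the future, leaving
    the sum and the newest residual to be rotated.\<close>
  define G where "G s v = (\<integral>\<^sup>+\<xi>. \<integral>\<^sup>+\<zeta>. f s ((\<Sum>j<n. (\<xi> j)\<^sup>2) + v\<^sup>2) \<zeta> \<partial>\<S> \<partial>\<S>)" for s v
  have [measurable]: "(\<lambda>(s, v). G s v) \<in> borel_measurable (borel \<Otimes>\<^sub>M borel)"
    unfolding G_def by measurable
  have sum_Suc: "(\<Sum>j<Suc (Suc n). case_nat z \<zeta> j) = z + (\<Sum>j<Suc n. \<zeta> j)" for z and \<zeta> :: "nat \<Rightarrow> real"
    by (simp add: sum.lessThan_Suc_shift del: sum.lessThan_Suc)
  have dev_Suc: "sq_dev (Suc (Suc n)) (case_nat z \<zeta>) = sq_dev (Suc n) \<zeta> + m / (m + 1) * (z - (\<Sum>j<Suc n. \<zeta> j) / m)\<^sup>2" for z \<zeta>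
    by (subst sq_dev_case_nat) (simp_all add: m_def add.commute)
  have "(\<integral>\<^sup>+\<zeta>. f (\<Sum>j<Suc (Suc n). \<zeta> j) (sq_dev (Suc (Suc n)) \<zeta>) (seq_shift (Suc (Suc n)) \<zeta>) \<partial>\<S>)
     = (\<integral>\<^sup>+z. \<integral>\<^sup>+\<zeta>. f (z + (\<Sum>j<Suc n. \<zeta> j)) (sq_dev (Suc n) \<zeta> + m / (m + 1) * (z - (\<Sum>j<Suc n. \<zeta> j) / m)\<^sup>2)
         (seq_shift (Suc n) \<zeta>) \<partial>\<S> \<partial>\<N>)"
    by (subst nn_integral_std_normal_seq_iter) (measurable, simp only: sum_Suc dev_Suc seq_shift_simps)
  also have "\<dots> = (\<integral>\<^sup>+z. \<integral>\<^sup>+z'. \<integral>\<^sup>+\<xi>. \<integral>\<^sup>+\<zeta>. f (z + sqrt (real (Suc n)) * z')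
       ((\<Sum>j<n. (\<xi> j)\<^sup>2) + m / (m + 1) * (z - sqrt (real (Suc n)) * z' / m)\<^sup>2) \<zeta> \<partial>\<S> \<partial>\<S> \<partial>\<N> \<partial>\<N>)"
    by (intro nn_integral_cong Suc.IH[of "\<lambda>s q \<zeta>. f (z + s) (q + m / (m + 1) * (z - s / m)\<^sup>2) \<zeta>" for z]) measurable
  also have "\<dots> = (\<integral>\<^sup>+z. \<integral>\<^sup>+z'. G (sqrt (m + 1) * (a * z + b * z')) (b * z - a * z') \<partial>\<N> \<partial>\<N>)"
  proof -
    have 1: "sqrt (m + 1) * (a * z + b * z') = z + sqrt (real (Suc n)) * z'" for z z'
      using m by (simp add: a_def b_def m_def field_simps)
    have 2: "m / (m + 1) * (z - sqrt (real (Suc n)) * z' / m)\<^sup>2 = (b * z - a * z')\<^sup>2" for z z'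
    proof -
      have "sqrt m * (z - sqrt m * z' / m) = sqrt m * z - z'"
        using m by (simp add: right_diff_distrib flip: mult.assoc)
      then have "sqrt m / sqrt (m + 1) * (z - sqrt m * z' / m) = (sqrt m * z - z') / sqrt (m + 1)"
        by simp
      then have "(sqrt m / sqrt (m + 1))\<^sup>2 * (z - sqrt m * z' / m)\<^sup>2 = ((sqrt m * z - z') / sqrt (m + 1))\<^sup>2"
        by (metis power_mult_distrib)
      then show ?thesis
        using m unfolding m_def[symmetric] by (simp add: a_def b_def diff_divide_distrib power_divide)
    qed
    show ?thesis unfolding G_def 1 2 ..
  qed
  also have "\<dots> = (\<integral>\<^sup>+z. \<integral>\<^sup>+z'. G (sqrt (m + 1) * z) z' \<partial>\<N> \<partial>\<N>)"
    by (rule std_normal_rotation[where f = "\<lambda>x y. G (sqrt (m + 1) * x) y"]) (use ab in auto)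
  also have "\<dots> = (\<integral>\<^sup>+z. \<integral>\<^sup>+\<xi>. \<integral>\<^sup>+\<zeta>. f (sqrt (m + 1) * z) (\<Sum>j<Suc n. (\<xi> j)\<^sup>2) \<zeta> \<partial>\<S> \<partial>\<S> \<partial>\<N>)"
  proof (rule nn_integral_cong)
    fix z
    show "(\<integral>\<^sup>+z'. G (sqrt (m + 1) * z) z' \<partial>\<N>)
       = (\<integral>\<^sup>+\<xi>. \<integral>\<^sup>+\<zeta>. f (sqrt (m + 1) * z) (\<Sum>j<Suc n. (\<xi> j)\<^sup>2) \<zeta> \<partial>\<S> \<partial>\<S>)"
      unfolding G_def
      by (subst (2) nn_integral_std_normal_seq_iter)
         (auto simp: sum.lessThan_Suc_shift add.commute simp del: sum.lessThan_Suc)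
  qed
  finally show ?case by (simp add: m_def add.commute)
qed

section \<open>Laplace transform of the chi-squared distribution\<close>

lemma std_normal_laplace_sq:
  assumes t: "0 \<le> t"
  shows "(\<integral>\<^sup>+z. ennreal (exp (- t * z\<^sup>2)) \<partial>\<N>) = ennreal ((1 + 2 * t) powr (- 1 / 2))"
proof -
  \<comment> \<open>Tilting the standard normal density by exp (-t z^2) gives \<sigma> times the
    centred normal density of variance 1 / (1 + 2 t).\<close>
  define \<sigma> where "\<sigma> = 1 / sqrt (1 + 2 * t)"
  have \<sigma>: "0 < \<sigma>" "\<sigma>\<^sup>2 = 1 / (1 + 2 * t)" using t by (auto simp: \<sigma>_def power_divide)
  have eq: "std_normal_density z * exp (- t * z\<^sup>2) = \<sigma> * normal_density 0 \<sigma> z" for z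
  proof -
    have "- z\<^sup>2 / 2 + - t * z\<^sup>2 = - (z\<^sup>2 / (2 * \<sigma>\<^sup>2))" unfolding \<sigma>(2) using t by (simp add: field_simps)
    then have "exp (- z\<^sup>2 / 2) * exp (- t * z\<^sup>2) = exp (- (z\<^sup>2 / (2 * \<sigma>\<^sup>2)))" by (metis exp_add)
    moreover have "sqrt (2 * pi * \<sigma>\<^sup>2) = sqrt (2 * pi) * \<sigma>" using \<sigma>(1) by (simp add: real_sqrt_mult)
    ultimately show ?thesis using \<sigma>(1) by (simp add: std_normal_density_def normal_density_def)
  qed
  have "(\<integral>\<^sup>+z. ennreal (exp (- t * z\<^sup>2)) \<partial>\<N>) = (\<integral>\<^sup>+z. ennreal (\<sigma> * normal_density 0 \<sigma> z) \<partial>lborel)"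
    by (subst nn_integral_density) (auto simp: eq[symmetric] ennreal_mult)
  also have "\<dots> = ennreal \<sigma>"
    using \<sigma>(1) by (subst nn_integral_eq_integral) auto
  also have "\<sigma> = (1 + 2 * t) powr (- 1 / 2)"
    using t by (simp add: \<sigma>_def powr_minus_divide powr_half_sqrt)
  finally show ?thesis .
qed

lemma chi_squared_laplace:
  assumes t: "0 \<le> t"
  shows "(\<integral>\<^sup>+\<xi>. ennreal (exp (- t * (\<Sum>j<n. (\<xi> j)\<^sup>2))) \<partial>\<S>) = ennreal ((1 + 2 * t) powr (- real n / 2))"
proof (induction n)
  case 0
  then show ?case using t by (simp add: std_normal_seq.emeasure_space_1)
next
  case (Suc n)
  have "(\<integral>\<^sup>+\<xi>. ennreal (exp (- t * (\<Sum>j<Suc n. (\<xi> j)\<^sup>2))) \<partial>\<S>)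
      = (\<integral>\<^sup>+z. \<integral>\<^sup>+\<xi>. ennreal (exp (- t * z\<^sup>2)) * ennreal (exp (- t * (\<Sum>j<n. (\<xi> j)\<^sup>2))) \<partial>\<S> \<partial>\<N>)"
    by (subst nn_integral_std_normal_seq_iter)
       (auto simp: sum.lessThan_Suc_shift distrib_left exp_add exp_diff exp_minus field_simps ennreal_mult[symmetric]
         simp del: sum.lessThan_Suc)
  also have "\<dots> = (\<integral>\<^sup>+z. ennreal (exp (- t * z\<^sup>2)) \<partial>\<N>) * ennreal ((1 + 2 * t) powr (- real n / 2))"
    by (subst nn_integral_cmult) (auto simp: Suc[simplified] nn_integral_multc)
  also have "\<dots> = ennreal ((1 + 2 * t) powr (- 1 / 2) * (1 + 2 * t) powr (- real n / 2))"
    using std_normal_laplace_sq[OF t] by (simp add: ennreal_mult)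
  also have "(1 + 2 * t) powr (- 1 / 2) * (1 + 2 * t) powr (- real n / 2) = (1 + 2 * t) powr (- real (Suc n) / 2)"
    by (simp add: powr_add[symmetric] field_simps)
  finally show ?case .
qed

text \<open>The Laplace transform is applied term by term. As the signs alternate, this is done for
  the Bochner integral; nonnegativity of \<open>triangle_error\<close> then leads back to the
  nonnegative integral.\<close>

lemma triangle_error_chi_squared:
  assumes c: "1 \<le> c" and \<eta>: "0 \<le> \<eta>"
  shows "(\<integral>\<^sup>+\<xi>. ennreal (triangle_error c (\<eta> / real c * (\<Sum>j<n. (\<xi> j)\<^sup>2))) \<partial>\<S>) = ennreal (g_fun c n \<eta>)"
proof -
  define t where "t m = (2 * real c - real m) * real m * (\<eta> / real c)" for m
  define a where "a m = (-1) ^ (m + 1) * (1 - (1/2) * of_bool (m = c) :: real)" for m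
  have L: "has_bochner_integral \<S> (\<lambda>\<xi>. exp (- t m * (\<Sum>j<n. (\<xi> j)\<^sup>2))) ((1 + 2 * t m) powr (- real n / 2))"
    if "m \<in> {1..c}" for m
    using that \<eta> by (intro has_bochner_integral_nn_integral chi_squared_laplace) (auto simp: t_def)
  have eq: "triangle_error c (\<eta> / real c * s) = (\<Sum>m=1..c. a m * exp (- t m * s))" for s
    by (auto simp: triangle_error_def a_def t_def mult_ac intro!: sum.cong)
  have "has_bochner_integral \<S> (\<lambda>\<xi>. triangle_error c (\<eta> / real c * (\<Sum>j<n. (\<xi> j)\<^sup>2)))
      (\<Sum>m=1..c. a m * (1 + 2 * t m) powr (- real n / 2))"
    unfolding eq by (intro has_bochner_integral_sum has_bochner_integral_mult_right L)
  also have "(\<Sum>m=1..c. a m * (1 + 2 * t m) powr (- real n / 2)) = g_fun c n \<eta>"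
    unfolding g_fun_def a_def t_def by (intro sum.cong refl) (simp add: field_simps)
  finally show ?thesis
    using \<eta> c by (simp add: has_bochner_integral_iff nn_integral_eq_integral triangle_error_nonneg sum_nonneg)
qed

text \<open>The event behind \<open>up_prob\<close>, with the same recursion: each step consumes the
  head of \<zeta> and passes on the shifted sequence, so that probabilities follow by splitting off
  the first coordinate.\<close>

fun up_exit :: "nat \<Rightarrow> real \<Rightarrow> nat \<Rightarrow> real \<Rightarrow> real \<Rightarrow> (nat \<Rightarrow> real) \<Rightarrow> bool" where
  "up_exit c \<theta> 0 u x \<zeta> = False"
| "up_exit c \<theta> (Suc k) u x \<zeta> =
     (if x \<le> - max 0 u then False else if x \<ge> max 0 u then True
      else up_exit c \<theta> k (u - \<theta>\<^sup>2 / 2) (x + \<theta> * \<zeta> 0 - real c * \<theta>\<^sup>2) (seq_shift (Suc 0) \<zeta>))"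

lemma up_exit_measurable_triple:
  "(\<lambda>(u, x, \<zeta>). up_exit c \<theta> k u x \<zeta>) \<in> measurable (borel \<Otimes>\<^sub>M borel \<Otimes>\<^sub>M \<S>) (count_space UNIV)"
proof (induction k)
  case (Suc k)
  note [measurable (raw)] = measurable_compose3[OF Suc.IH]
  show ?case unfolding up_exit.simps split_beta' by measurable
qed simp

lemmas up_exit_measurable[measurable (raw)] = measurable_compose3[OF up_exit_measurable_triple]

lemma sets_up_exit: "{\<zeta>. up_exit c \<theta> k u x \<zeta>} \<in> sets \<S>"
proof -
  have "{\<zeta> \<in> space \<S>. up_exit c \<theta> k u x \<zeta>} \<in> sets \<S>" by measurable
  then show ?thesis by (simp add: space_std_normal_seq)
qed

lemma up_exit_prob: "emeasure \<S> {\<zeta>. up_exit c \<theta> k u x \<zeta>} = ennreal (up_prob c \<theta> k u x)"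
proof (induction k arbitrary: u x)
  case (Suc k)
  show ?case
  proof (cases "- max 0 u < x \<and> x < max 0 u")
    case True
    let ?n = "\<lambda>z. x + \<theta> * z - real c * \<theta>\<^sup>2"
    have eq: "up_exit c \<theta> (Suc k) u x \<zeta> = up_exit c \<theta> k (u - \<theta>\<^sup>2 / 2) (?n (\<zeta> 0)) (seq_shift (Suc 0) \<zeta>)" for \<zeta>
      using True by (auto simp: not_le[symmetric])
    have [measurable]: "{\<zeta>. up_exit c \<theta> k (u - \<theta>\<^sup>2 / 2) (?n (\<zeta> 0)) (seq_shift (Suc 0) \<zeta>)} \<in> sets \<S>"
      using sets_up_exit[of c \<theta> "Suc k" u x] unfolding eq .
    have "emeasure \<S> {\<zeta>. up_exit c \<theta> (Suc k) u x \<zeta>}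
        = (\<integral>\<^sup>+\<zeta>. indicator {\<zeta>. up_exit c \<theta> k (u - \<theta>\<^sup>2 / 2) (?n (\<zeta> 0)) (seq_shift (Suc 0) \<zeta>)} \<zeta> \<partial>\<S>)"
      unfolding eq by (subst nn_integral_indicator) auto
    also have "\<dots> = (\<integral>\<^sup>+z. \<integral>\<^sup>+\<zeta>. indicator {\<zeta>. up_exit c \<theta> k (u - \<theta>\<^sup>2 / 2) (?n z) \<zeta>} \<zeta> \<partial>\<S> \<partial>\<N>)"
      by (subst nn_integral_std_normal_seq_iter) (auto simp: indicator_def[abs_def])
    also have "\<dots> = (\<integral>\<^sup>+z. ennreal (up_prob c \<theta> k (u - \<theta>\<^sup>2 / 2) (?n z)) \<partial>\<N>)"
      using Suc.IH by (simp add: sets_up_exit)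
    also have "\<dots> = ennreal (\<integral>z. up_prob c \<theta> k (u - \<theta>\<^sup>2 / 2) (?n z) \<partial>\<N>)"
      by (intro nn_integral_eq_integral std_normal.integrable_const_bound[where B = 1])
         (auto simp: up_prob_nonneg up_prob_le_1)
    finally show ?thesis using True by auto
  next
    case False
    then show ?thesis
      using std_normal_seq.emeasure_space_1 by (auto simp: space_std_normal_seq)
  qed
next
  case 0
  have "{\<zeta>. up_exit c \<theta> 0 u x \<zeta>} = {}" by simp
  then show ?case by (metis emeasure_empty ennreal_0 up_prob.simps(1))
qed


text \<open>Makes the events increase with the number of inspections, so that bounds for finite
  horizons pass to the limit.\<close>

lemma up_exit_Suc: "up_exit c \<theta> k u x \<zeta> \<Longrightarrow> up_exit c \<theta> (Suc k) u x \<zeta>"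
proof (induction k arbitrary: u x \<zeta>)
  case (Suc k)
  from Suc.prems show ?case
    unfolding up_exit.simps(2)[of c \<theta> "Suc k" u x \<zeta>] up_exit.simps(2)[of c \<theta> k u x \<zeta>]
    using Suc.IH by (auto simp del: up_exit.simps split: if_splits)
qed simp

text \<open>Unrolls the recursion along a path; d moves need d + 1 inspections. The last assumption
  excludes a tie at 0 past the apex, which \<open>up_exit\<close> counts as a lower exit.\<close>

lemma up_exitI:
  assumes "\<And>i. i < d \<Longrightarrow> \<bar>x + \<theta> * (\<Sum>j<i. \<zeta> j) - real c * \<theta>\<^sup>2 * real i\<bar> < max 0 (u - \<theta>\<^sup>2 / 2 * real i)"
    and "max 0 (u - \<theta>\<^sup>2 / 2 * real d) \<le> x + \<theta> * (\<Sum>j<d. \<zeta> j) - real c * \<theta>\<^sup>2 * real d"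
    and "x + \<theta> * (\<Sum>j<d. \<zeta> j) - real c * \<theta>\<^sup>2 * real d \<noteq> 0"
  shows "up_exit c \<theta> (Suc d) u x \<zeta>"
  using assms
proof (induction d arbitrary: u x \<zeta>)
  case 0
  then show ?case by auto
next
  case (Suc d)
  have "up_exit c \<theta> (Suc d) (u - \<theta>\<^sup>2 / 2) (x + \<theta> * \<zeta> 0 - real c * \<theta>\<^sup>2) (seq_shift (Suc 0) \<zeta>)"
  proof (rule Suc.IH)
    fix i assume "i < d"
    then show "\<bar>x + \<theta> * \<zeta> 0 - real c * \<theta>\<^sup>2 + \<theta> * (\<Sum>j<i. seq_shift (Suc 0) \<zeta> j) - real c * \<theta>\<^sup>2 * real i\<bar>
        < max 0 (u - \<theta>\<^sup>2 / 2 - \<theta>\<^sup>2 / 2 * real i)"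
      using Suc.prems(1)[of "Suc i"]
      by (simp add: seq_shift_def sum.lessThan_Suc_shift algebra_simps add_divide_distrib del: sum.lessThan_Suc)
  qed (use Suc.prems(2,3) in \<open>simp_all add: seq_shift_def sum.lessThan_Suc_shift algebra_simps add_divide_distrib del: sum.lessThan_Suc\<close>)
  then show ?case
    using Suc.prems(1)[of 0] by (subst up_exit.simps) (auto split: if_splits simp del: up_exit.simps)
qed

subsection \<open>First exit of a Gaussian random walk\<close>

lemma sets_std_normal_seq_Collect:
  assumes "Measurable.pred \<S> P"
  shows "{\<zeta>. P \<zeta>} \<in> sets \<S>"
  using predE[OF assms] by (simp add: space_std_normal_seq)

text \<open>Unlike in \<open>up_exit\<close>, a zero walk on a vanished boundary counts as an upper
  exit here, which fits the closed stopping conditions of the procedure in both directions. For the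
  normalised walk the two conventions differ on a null set only
  (\<open>std_walk_nonzero\<close>).\<close>

definition first_up :: "nat \<Rightarrow> (nat \<Rightarrow> real) \<Rightarrow> (nat \<Rightarrow> real) \<Rightarrow> bool" where
  "first_up n b w \<longleftrightarrow> (\<exists>r\<ge>n. b r \<le> w r \<and> (\<forall>r'\<in>{n..<r}. \<bar>w r'\<bar> < b r'))"

text \<open>The larger walk reaches the upper boundary no later than the smaller one. Before that it
  cannot have left below, since the smaller walk has not.\<close>

lemma first_up_mono:
  assumes up: "first_up n b w" and le: "\<And>r. n \<le> r \<Longrightarrow> w r \<le> w' r"
  shows "first_up n b w'"
proof -
  obtain r where r: "n \<le> r" "b r \<le> w r" "\<And>r'. n \<le> r' \<Longrightarrow> r' < r \<Longrightarrow> \<bar>w r'\<bar> < b r'"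
    using up by (auto simp: first_up_def)
  define s where "s = (LEAST s. n \<le> s \<and> b s \<le> w' s)"
  have "n \<le> r \<and> b r \<le> w' r" using r le[of r] by auto
  then have s: "n \<le> s" "b s \<le> w' s" "s \<le> r"
    unfolding s_def by (metis (mono_tags, lifting) LeastI, metis (mono_tags, lifting) LeastI, simp add: Least_le)
  have "\<bar>w' r'\<bar> < b r'" if "n \<le> r'" "r' < s" for r'
    using that s r(3)[of r'] le[of r'] not_less_Least[of r' "\<lambda>s. n \<le> s \<and> b s \<le> w' s"]
    by (auto simp: s_def[symmetric] abs_less_iff)
  then show ?thesis using s by (auto simp: first_up_def)
qed

lemma first_up_scale:
  assumes "0 < \<kappa>"
  shows "first_up n (\<lambda>r. \<kappa> * b r) (\<lambda>r. \<kappa> * w r) \<longleftrightarrow> first_up n b w"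
  using assms by (simp add: first_up_def abs_mult)

text \<open>The boundary falls linearly in r until it is 0, where any value of the monitor meets a
  stopping condition; hence every subroutine stops.\<close>

lemma sub_bound_eventually_0:
  assumes "1 \<le> c" "0 < \<epsilon>"
  shows "\<exists>r\<ge>n. sub_bound c n0 \<eta> \<epsilon> x r = 0"
proof -
  obtain r :: nat where r: "h_squared c n0 \<eta> * sample_variance n0 x / (2 * real c * \<epsilon>) / (\<epsilon> / (2 * real c)) \<le> real r"
    using real_arch_simple by blast
  have "real r \<le> real (max n r)" by simp
  from order_trans[OF r this]
  have "h_squared c n0 \<eta> * sample_variance n0 x / (2 * real c * \<epsilon>) \<le> real (max n r) * (\<epsilon> / (2 * real c))"
    using assms by (simp only: pos_divide_le_eq divide_pos_pos mult_pos_pos of_nat_0_less_iff zero_less_numeral less_le_trans[OF zero_less_one])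
  then have "sub_bound c n0 \<eta> \<epsilon> x (max n r) = 0"
    by (simp add: sub_bound_def boundary_def mult.commute)
  then show ?thesis by (intro exI[of _ "max n r"]) auto
qed

lemma sub_stop_props:
  assumes "1 \<le> c" "0 < \<epsilon>" and r_def: "r = sub_stop c n0 \<eta> \<epsilon> a x"
  shows "n0 \<le> r"
    and "sub_bound c n0 \<eta> \<epsilon> x r \<le> \<bar>monitor a x r\<bar>"
    and "\<And>r'. n0 \<le> r' \<Longrightarrow> r' < r \<Longrightarrow> \<bar>monitor a x r'\<bar> < sub_bound c n0 \<eta> \<epsilon> x r'"
proof -
  let ?P = "\<lambda>r. n0 \<le> r \<and> (monitor a x r \<le> - sub_bound c n0 \<eta> \<epsilon> x r \<or> monitor a x r \<ge> sub_bound c n0 \<eta> \<epsilon> x r)"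
  have r: "r = (LEAST r. ?P r)" by (simp add: r_def sub_stop_def)
  obtain r0 where "n0 \<le> r0" "sub_bound c n0 \<eta> \<epsilon> x r0 = 0"
    using sub_bound_eventually_0[OF assms(1,2)] by blast
  then have "?P r0" by auto
  then have P: "?P r" unfolding r by (rule LeastI)
  then show "n0 \<le> r" "sub_bound c n0 \<eta> \<epsilon> x r \<le> \<bar>monitor a x r\<bar>" by auto
  show "\<bar>monitor a x r'\<bar> < sub_bound c n0 \<eta> \<epsilon> x r'" if "n0 \<le> r'" "r' < r" for r'
    using not_less_Least[of r' ?P] that unfolding r by auto
qed

lemma sub_decision_cases: "sub_decision c n0 \<eta> \<epsilon> a x = 1 \<or> sub_decision c n0 \<eta> \<epsilon> a x = -1"
  by (simp add: sub_decision_def Let_def)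

lemma infeasible_first_up:
  assumes "1 \<le> c" "0 < \<epsilon>" "sub_decision c n0 \<eta> \<epsilon> a x = -1"
  shows "first_up n0 (sub_bound c n0 \<eta> \<epsilon> x) (monitor a x)"
proof -
  let ?r = "sub_stop c n0 \<eta> \<epsilon> a x"
  note p = sub_stop_props[OF assms(1,2), of ?r n0 \<eta> a x, OF refl]
  have "- sub_bound c n0 \<eta> \<epsilon> x ?r < monitor a x ?r"
    using assms(3) by (auto simp: sub_decision_def Let_def not_le split: if_splits)
  then have "sub_bound c n0 \<eta> \<epsilon> x ?r \<le> monitor a x ?r" using p(2) by linarith
  then show ?thesis using p(1,3) by (auto simp: first_up_def)
qed

lemma feasible_first_up:
  assumes "1 \<le> c" "0 < \<epsilon>" "sub_decision c n0 \<eta> \<epsilon> a x = 1"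
  shows "first_up n0 (sub_bound c n0 \<eta> \<epsilon> x) (\<lambda>r. - monitor a x r)"
proof -
  let ?r = "sub_stop c n0 \<eta> \<epsilon> a x"
  note p = sub_stop_props[OF assms(1,2), of ?r n0 \<eta> a x, OF refl]
  have "sub_bound c n0 \<eta> \<epsilon> x ?r \<le> - monitor a x ?r"
    using assms(3) by (auto simp: sub_decision_def Let_def split: if_splits)
  then show ?thesis using p(1,3) by (auto simp: first_up_def)
qed

context
  fixes c n :: nat and \<theta> \<eta> :: real
begin

text \<open>Normalised units: under \<open>\<S>\<close> each step has variance \<theta>^2 and mean
  -c \<theta>^2, and the boundary below shrinks by \<theta>^2 / 2 per step, as in
  \<open>up_prob\<close>. The drift points away from the upper side, so an upper exit is an
  error.\<close>

definition std_walk :: "(nat \<Rightarrow> real) \<Rightarrow> nat \<Rightarrow> real" where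
  "std_walk \<zeta> r = \<theta> * (\<Sum>j<r. \<zeta> j) - real c * \<theta>\<^sup>2 * real r"

definition std_bound :: "(nat \<Rightarrow> real) \<Rightarrow> nat \<Rightarrow> real" where
  "std_bound \<zeta> r = max 0 (\<eta> / real c * sq_dev n \<zeta> - \<theta>\<^sup>2 / 2 * real r)"

lemma std_walk_measurable[measurable]: "(\<lambda>\<zeta>. std_walk \<zeta> r) \<in> borel_measurable \<S>"
  unfolding std_walk_def by measurable

lemma std_bound_measurable[measurable]: "(\<lambda>\<zeta>. std_bound \<zeta> r) \<in> borel_measurable \<S>"
  unfolding std_bound_def by measurable

lemma sets_first_up: "{\<zeta>. first_up n (std_bound \<zeta>) (std_walk \<zeta>)} \<in> sets \<S>"
proof -
  have "{\<zeta>. first_up n (std_bound \<zeta>) (std_walk \<zeta>)}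
      = (\<Union>r\<in>{n..}. {\<zeta> \<in> space \<S>. std_bound \<zeta> r \<le> std_walk \<zeta> r}
          - (\<Union>r'\<in>{n..<r}. {\<zeta> \<in> space \<S>. std_bound \<zeta> r' \<le> \<bar>std_walk \<zeta> r'\<bar>}))"
    by (auto simp: first_up_def space_std_normal_seq not_le)
  also have "\<dots> \<in> sets \<S>"
    by (intro sets.countable_UN'' sets.Diff sets.finite_UN) auto
  finally show ?thesis .
qed

text \<open>By \<open>helmert\<close> the sum of r + 1 coordinates is distributed as sqrt (r + 1)
  times a standard normal variable, which has no atoms. This removes ties past the apex.\<close>

lemma std_walk_nonzero:
  assumes \<theta>: "0 < \<theta>"
  shows "AE \<zeta> in \<S>. std_walk \<zeta> (Suc r) \<noteq> 0"
proof -
  define x where "x = real c * \<theta>\<^sup>2 * real (Suc r) / (\<theta> * sqrt (real (Suc r)))"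
  let ?g = "\<lambda>s (q::real) (\<zeta>::nat \<Rightarrow> real). of_bool (\<theta> * s - real c * \<theta>\<^sup>2 * real (Suc r) = 0) :: ennreal"
  have zero: "{\<zeta>. std_walk \<zeta> (Suc r) = 0} \<in> sets \<S>"
    by (rule sets_std_normal_seq_Collect) measurable
  have "emeasure \<S> {\<zeta>. std_walk \<zeta> (Suc r) = 0} = (\<integral>\<^sup>+\<zeta>. ?g (\<Sum>j<Suc r. \<zeta> j) (sq_dev (Suc r) \<zeta>) (seq_shift (Suc r) \<zeta>) \<partial>\<S>)"
    unfolding nn_integral_indicator[OF zero, symmetric]
    by (intro nn_integral_cong) (simp add: std_walk_def indicator_def del: sum.lessThan_Suc)
  also have "\<dots> = (\<integral>\<^sup>+z. \<integral>\<^sup>+\<xi>. \<integral>\<^sup>+\<zeta>. ?g (sqrt (real (Suc r)) * z) (\<Sum>j<r. (\<xi> j)\<^sup>2) \<zeta> \<partial>\<S> \<partial>\<S> \<partial>\<N>)"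
    by (rule helmert) (simp add: of_bool_def split_beta')
  also have "\<dots> = (\<integral>\<^sup>+z. indicator {x} z \<partial>\<N>)"
  proof (rule nn_integral_cong)
    fix z
    have "\<theta> * (sqrt (real (Suc r)) * z) - real c * \<theta>\<^sup>2 * real (Suc r) = 0 \<longleftrightarrow> z = x"
      using \<theta> by (simp only: x_def eq_divide_eq) (auto simp: mult_ac)
    then show "(\<integral>\<^sup>+\<xi>. \<integral>\<^sup>+\<zeta>. ?g (sqrt (real (Suc r)) * z) (\<Sum>j<r. (\<xi> j)\<^sup>2) \<zeta> \<partial>\<S> \<partial>\<S>) = indicator {x} z"
      by (simp only: nn_integral_const std_normal_seq.emeasure_space_1 mult_1_right) (simp add: indicator_def)
  qed
  also have "\<dots> = 0"
    by (subst nn_integral_density) (auto intro!: nn_integral_0_iff_AE[THEN iffD2] AE_mp[OF AE_lborel_singleton[of x]])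
  finally show ?thesis
    by (intro AE_I[where N = "{\<zeta>. std_walk \<zeta> (Suc r) = 0}"] zero) auto
qed

text \<open>\<open>helmert\<close> separates the sum at time n, the squared deviations and the
  future increments. With the deviations fixed, the first n observations act as the single first
  step of \<open>up_prob_start\<close>; averaging over the n - 1 residual squares gives
  \<open>g_fun\<close>.\<close>

lemma up_exit_bound:
  assumes c: "1 \<le> c" and n: "1 \<le> n" and \<theta>: "0 < \<theta>" and \<eta>: "0 \<le> \<eta>"
  shows "emeasure \<S> {\<zeta>. up_exit c \<theta> k (\<eta> / real c * sq_dev n \<zeta> - \<theta>\<^sup>2 / 2 * real n) (std_walk \<zeta> n) (seq_shift n \<zeta>)}
    \<le> ennreal (g_fun c (n - 1) \<eta>)"
proof -
  obtain m where m: "n = Suc m" using n by (cases n) auto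
  interpret NS: pair_sigma_finite "\<N>" "\<S>" ..
  \<comment> \<open>Standard deviation of the walk at time n, the size of the merged first
    step.\<close>
  define \<tau> where "\<tau> = \<theta> * sqrt (real n)"
  have \<tau>: "0 < \<tau>" "\<tau>\<^sup>2 = \<theta>\<^sup>2 * real n" using \<theta> n by (auto simp: \<tau>_def power_mult_distrib)
  let ?v = "\<lambda>q. \<eta> / real c * q"
  let ?f = "\<lambda>s q \<zeta>. of_bool (up_exit c \<theta> k (?v q - \<theta>\<^sup>2 / 2 * real n) (\<theta> * s - real c * \<theta>\<^sup>2 * real n) \<zeta>) :: ennreal"
  have E: "{\<zeta>. up_exit c \<theta> k (?v (sq_dev n \<zeta>) - \<theta>\<^sup>2 / 2 * real n) (std_walk \<zeta> n) (seq_shift n \<zeta>)} \<in> sets \<S>"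
    by (rule sets_std_normal_seq_Collect) measurable
  have "emeasure \<S> {\<zeta>. up_exit c \<theta> k (?v (sq_dev n \<zeta>) - \<theta>\<^sup>2 / 2 * real n) (std_walk \<zeta> n) (seq_shift n \<zeta>)}
    = (\<integral>\<^sup>+\<zeta>. ?f (\<Sum>j<n. \<zeta> j) (sq_dev n \<zeta>) (seq_shift n \<zeta>) \<partial>\<S>)"
    unfolding nn_integral_indicator[OF E, symmetric]
    by (intro nn_integral_cong) (simp add: std_walk_def indicator_def)
  also have "\<dots> = (\<integral>\<^sup>+z. \<integral>\<^sup>+\<xi>. \<integral>\<^sup>+\<zeta>. ?f (sqrt (real n) * z) (\<Sum>j<m. (\<xi> j)\<^sup>2) \<zeta> \<partial>\<S> \<partial>\<S> \<partial>\<N>)"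
    unfolding m by (rule helmert) measurable
  also have "\<dots> = (\<integral>\<^sup>+z. \<integral>\<^sup>+\<xi>. ennreal (up_prob c \<theta> k (?v (\<Sum>j<m. (\<xi> j)\<^sup>2) - \<tau>\<^sup>2 / 2) (\<tau> * z - real c * \<tau>\<^sup>2)) \<partial>\<S> \<partial>\<N>)"
  proof (intro nn_integral_cong)
    fix z \<xi>
    have "(\<integral>\<^sup>+\<zeta>. ?f s q \<zeta> \<partial>\<S>) = ennreal (up_prob c \<theta> k (?v q - \<theta>\<^sup>2 / 2 * real n) (\<theta> * s - real c * \<theta>\<^sup>2 * real n))" for s q
      using sets_up_exit by (subst up_exit_prob[symmetric], subst nn_integral_indicator[symmetric]) (auto simp: indicator_def[abs_def])
    then show "(\<integral>\<^sup>+\<zeta>. ?f (sqrt (real n) * z) (\<Sum>j<m. (\<xi> j)\<^sup>2) \<zeta> \<partial>\<S>)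
      = ennreal (up_prob c \<theta> k (?v (\<Sum>j<m. (\<xi> j)\<^sup>2) - \<tau>\<^sup>2 / 2) (\<tau> * z - real c * \<tau>\<^sup>2))"
      by (simp only: \<tau>(2)) (simp add: \<tau>_def mult.assoc)
  qed
  also have "\<dots> = (\<integral>\<^sup>+\<xi>. \<integral>\<^sup>+z. ennreal (up_prob c \<theta> k (?v (\<Sum>j<m. (\<xi> j)\<^sup>2) - \<tau>\<^sup>2 / 2) (\<tau> * z - real c * \<tau>\<^sup>2)) \<partial>\<N> \<partial>\<S>)"
    by (rule NS.Fubini'[symmetric]) measurable
  also have "\<dots> \<le> (\<integral>\<^sup>+\<xi>. ennreal (triangle_error c (?v (\<Sum>j<m. (\<xi> j)\<^sup>2))) \<partial>\<S>)"
  proof (rule nn_integral_mono)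
    fix \<xi> :: "nat \<Rightarrow> real"
    let ?q = "\<Sum>j<m. (\<xi> j)\<^sup>2"
    have "(\<integral>\<^sup>+z. ennreal (up_prob c \<theta> k (?v ?q - \<tau>\<^sup>2 / 2) (\<tau> * z - real c * \<tau>\<^sup>2)) \<partial>\<N>)
      = ennreal (\<integral>z. up_prob c \<theta> k (?v ?q - \<tau>\<^sup>2 / 2) (\<tau> * z - real c * \<tau>\<^sup>2) \<partial>\<N>)"
      by (intro nn_integral_eq_integral std_normal.integrable_const_bound[where B = 1])
         (auto simp: up_prob_nonneg up_prob_le_1)
    also have "\<dots> \<le> ennreal (triangle_error c (?v ?q))"
      using \<eta> by (intro ennreal_leI up_prob_start c \<theta> \<tau>) (auto intro!: mult_nonneg_nonneg divide_nonneg_nonneg sum_nonneg)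
    finally show "(\<integral>\<^sup>+z. ennreal (up_prob c \<theta> k (?v ?q - \<tau>\<^sup>2 / 2) (\<tau> * z - real c * \<tau>\<^sup>2)) \<partial>\<N>)
      \<le> ennreal (triangle_error c (?v ?q))" .
  qed
  also have "\<dots> = ennreal (g_fun c (n - 1) \<eta>)"
    using triangle_error_chi_squared[OF c \<eta>, of m] by (simp add: m)
  finally show ?thesis .
qed

text \<open>Outside the null set of ties, the event is covered by the increasing union of the
  finite-horizon events \<open>up_exit\<close>.\<close>

lemma first_up_bound:
  assumes c: "1 \<le> c" and n: "1 \<le> n" and \<theta>: "0 < \<theta>" and \<eta>: "0 \<le> \<eta>"
  shows "emeasure \<S> {\<zeta>. first_up n (std_bound \<zeta>) (std_walk \<zeta>)} \<le> ennreal (g_fun c (n - 1) \<eta>)"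
proof -
  define A where "A k = {\<zeta>. up_exit c \<theta> k (\<eta> / real c * sq_dev n \<zeta> - \<theta>\<^sup>2 / 2 * real n) (std_walk \<zeta> n) (seq_shift n \<zeta>)}" for k
  have A[measurable]: "A k \<in> sets \<S>" for k
    unfolding A_def by (rule sets_std_normal_seq_Collect) measurable
  have "AE \<zeta> in \<S>. \<forall>r. std_walk \<zeta> (Suc r) \<noteq> 0"
    using std_walk_nonzero[OF \<theta>] by (simp add: AE_all_countable)
  then have "AE \<zeta> in \<S>. \<zeta> \<in> {\<zeta>. first_up n (std_bound \<zeta>) (std_walk \<zeta>)} \<longrightarrow> \<zeta> \<in> (\<Union>k. A k)"
  proof eventually_elim
    case (elim \<zeta>)
    show ?case
    proof
      assume "\<zeta> \<in> {\<zeta>. first_up n (std_bound \<zeta>) (std_walk \<zeta>)}"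
      then obtain r where r: "n \<le> r" "std_bound \<zeta> r \<le> std_walk \<zeta> r"
        "\<And>r'. n \<le> r' \<Longrightarrow> r' < r \<Longrightarrow> \<bar>std_walk \<zeta> r'\<bar> < std_bound \<zeta> r'"
        by (auto simp: first_up_def)
      have walk: "std_walk \<zeta> n + \<theta> * (\<Sum>j<i. seq_shift n \<zeta> j) - real c * \<theta>\<^sup>2 * real i = std_walk \<zeta> (n + i)" for i
      proof -
        have "(\<Sum>j<n + i. \<zeta> j) = (\<Sum>j<n. \<zeta> j) + (\<Sum>j<i. \<zeta> (j + n))"
          by (induction i) (auto simp: add.commute)
        then show ?thesis by (simp add: std_walk_def seq_shift_def algebra_simps)
      qed
      have bound: "max 0 (\<eta> / real c * sq_dev n \<zeta> - \<theta>\<^sup>2 / 2 * real n - \<theta>\<^sup>2 / 2 * real i) = std_bound \<zeta> (n + i)" for i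
        by (simp add: std_bound_def algebra_simps add_divide_distrib)
      \<comment> \<open>The times n, ..., r make r - n + 1 inspections.\<close>
      have "up_exit c \<theta> (Suc (r - n)) (\<eta> / real c * sq_dev n \<zeta> - \<theta>\<^sup>2 / 2 * real n) (std_walk \<zeta> n) (seq_shift n \<zeta>)"
      proof (rule up_exitI; unfold walk bound)
        show "std_walk \<zeta> (n + (r - n)) \<noteq> 0"
          using elim[rule_format, of "r - 1"] n r(1) by simp
      qed (use r in auto)
      then show "\<zeta> \<in> (\<Union>k. A k)" unfolding A_def by blast
    qed
  qed
  then have "emeasure \<S> {\<zeta>. first_up n (std_bound \<zeta>) (std_walk \<zeta>)} \<le> emeasure \<S> (\<Union>k. A k)"
    by (rule emeasure_mono_AE) auto
  also have "\<dots> = (SUP k. emeasure \<S> (A k))"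
    by (rule SUP_emeasure_incseq[symmetric]) (use A in auto, auto simp: A_def incseq_Suc_iff simp del: up_exit.simps intro: up_exit_Suc)
  also have "\<dots> \<le> ennreal (g_fun c (n - 1) \<eta>)"
    unfolding A_def by (intro SUP_least up_exit_bound assms)
  finally show ?thesis .
qed

end

lemma (in prob_space) iid_normal_distr:
  assumes indep: "indep_vars (\<lambda>_. borel) X {1..}"
    and normal: "\<And>j. 1 \<le> j \<Longrightarrow> distributed M lborel (X j) std_normal_density"
  shows "(\<lambda>\<omega> j. X (Suc j) \<omega>) \<in> measurable M \<S>" "distr M \<S> (\<lambda>\<omega> j. X (Suc j) \<omega>) = \<S>"
proof -
  have X: "random_variable borel (X (Suc j))" for j
    using distributed_measurable[OF normal, of "Suc j"] by simp
  then show "(\<lambda>\<omega> j. X (Suc j) \<omega>) \<in> measurable M \<S>"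
    by (intro measurable_std_normal_seqI)
  \<comment> \<open>Grouping the indices into singletons {j + 1} moves the family from observations
    numbered from 1 to coordinates numbered from 0.\<close>
  have "indep_vars (\<lambda>j. Pi\<^sub>M {Suc j} (\<lambda>_. borel)) (\<lambda>j \<omega>. \<lambda>i\<in>{Suc j}. X i \<omega>) UNIV"
    by (rule indep_vars_restrict[OF indep]) (auto simp: disjoint_family_on_def)
  then have "indep_vars (\<lambda>_. borel) (\<lambda>j \<omega>. (\<lambda>i\<in>{Suc j}. X i \<omega>) (Suc j)) UNIV"
    by (rule indep_vars_compose2[where Y = "\<lambda>j x. x (Suc j)"]) auto
  then have "indep_vars (\<lambda>_. borel) (\<lambda>j. X (Suc j)) UNIV" by simp
  then have "distr M (\<Pi>\<^sub>M i\<in>UNIV. borel) (\<lambda>\<omega>. \<lambda>i\<in>UNIV. X (Suc i) \<omega>) = (\<Pi>\<^sub>M i\<in>UNIV. distr M borel (X (Suc i)))"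
    by (subst (asm) indep_vars_iff_distr_eq_PiM) (use X in auto)
  also have "\<dots> = (\<Pi>\<^sub>M i\<in>UNIV. \<N>)"
    using distributed_distr_eq_density[OF normal] by (intro PiM_cong) (simp_all cong: distr_cong)
  finally have "distr M (\<Pi>\<^sub>M i\<in>UNIV. borel) (\<lambda>\<omega> j. X (Suc j) \<omega>) = \<S>"
    by (simp add: std_normal_seq_def restrict_def)
  moreover have "distr M (\<Pi>\<^sub>M i\<in>UNIV. borel) (\<lambda>\<omega> j. X (Suc j) \<omega>) = distr M \<S> (\<lambda>\<omega> j. X (Suc j) \<omega>)"
    by (rule distr_cong) (auto simp: std_normal_seq_def intro!: sets_PiM_cong)
  ultimately show "distr M \<S> (\<lambda>\<omega> j. X (Suc j) \<omega>) = \<S>" by simp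
qed

text \<open>Scaled by \<theta> / \<sigma>, the monitor lies pathwise below the normalised walk,
  whose drift corresponds to a margin of exactly \<epsilon>, so \<open>first_up_mono\<close>
  applies. The preimage of the normalised event serves as \<open>B\<close>; for a larger margin this
  gives an inclusion only.\<close>

lemma (in prob_space) wrong_side_prob:
  assumes indep: "indep_vars (\<lambda>_. borel) X {1..}"
    and normal: "\<And>j. 1 \<le> j \<Longrightarrow> distributed M lborel (X j) (normal_density \<mu> \<sigma>)"
    and \<sigma>: "0 < \<sigma>" and \<epsilon>: "0 < \<epsilon>" and \<mu>: "\<mu> \<le> a - \<epsilon>"
    and c: "1 \<le> c" and n0: "2 \<le> n0" and \<eta>: "0 < \<eta>"
  shows "\<exists>B\<in>sets M. {\<omega> \<in> space M. first_up n0 (sub_bound c n0 \<eta> \<epsilon> (\<lambda>j. X j \<omega>)) (monitor a (\<lambda>j. X j \<omega>))} \<subseteq> B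
    \<and> emeasure M B \<le> ennreal (g_fun c (n0 - 1) \<eta>)"
proof -
  define Z where "Z j \<omega> = (X j \<omega> - \<mu>) / \<sigma>" for j \<omega>
  \<comment> \<open>Solves c \<theta>^2 = (\<theta> / \<sigma>) \<epsilon>: scaling by \<theta> /
    \<sigma> turns the margin \<epsilon> into c times the step variance.\<close>
  define \<theta> where "\<theta> = \<epsilon> / (\<sigma> * real c)"
  have \<theta>: "0 < \<theta>" and \<epsilon>\<theta>: "\<epsilon> = real c * \<theta> * \<sigma>" using \<sigma> \<epsilon> c by (auto simp: \<theta>_def)
  have "indep_vars (\<lambda>_. borel) Z {1..}"
    unfolding Z_def by (rule indep_vars_compose2[OF indep]) auto
  moreover have "distributed M lborel (Z j) std_normal_density" if "1 \<le> j" for j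
    using normal_standard_normal_convert[OF \<sigma>, THEN iffD1, OF normal[OF that]] unfolding Z_def[abs_def] .
  ultimately have Z: "(\<lambda>\<omega> j. Z (Suc j) \<omega>) \<in> measurable M \<S>" "distr M \<S> (\<lambda>\<omega> j. Z (Suc j) \<omega>) = \<S>"
    using iid_normal_distr[of Z] by blast+
  let ?z = "\<lambda>\<omega> j. Z (Suc j) \<omega>"
  let ?E = "{\<zeta>. first_up n0 (std_bound c n0 \<theta> \<eta> \<zeta>) (std_walk c \<theta> \<zeta>)}"
  have E: "?E \<in> sets \<S>" by (rule sets_first_up)
  have sub: "first_up n0 (std_bound c n0 \<theta> \<eta> (?z \<omega>)) (std_walk c \<theta> (?z \<omega>))"
    if up: "first_up n0 (sub_bound c n0 \<eta> \<epsilon> (\<lambda>j. X j \<omega>)) (monitor a (\<lambda>j. X j \<omega>))" for \<omega>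
  proof -
    let ?x = "\<lambda>j. X j \<omega>"
    have x: "?x (Suc j) = \<mu> + \<sigma> * ?z \<omega> j" for j using \<sigma> by (simp add: Z_def)
    have sum: "(\<Sum>j=1..r. ?x j) = real r * \<mu> + \<sigma> * (\<Sum>j<r. ?z \<omega> j)" for r
    proof -
      have "(\<Sum>j=1..r. ?x j) = (\<Sum>j<r. ?x (Suc j))"
        by (rule sum.reindex_bij_witness[where i = Suc and j = "\<lambda>j. j - 1"]) auto
      also have "\<dots> = real r * \<mu> + \<sigma> * (\<Sum>j<r. ?z \<omega> j)"
        unfolding x sum.distrib sum_distrib_left by simp
      finally show ?thesis .
    qed
    have walk: "\<theta> / \<sigma> * monitor a ?x r \<le> std_walk c \<theta> (?z \<omega>) r" for r
    proof -
      have "monitor a ?x r = \<sigma> * (\<Sum>j<r. ?z \<omega> j) - real r * (a - \<mu>)"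
        by (simp add: monitor_def sum algebra_simps del: One_nat_def)
      also have "\<dots> \<le> \<sigma> * (\<Sum>j<r. ?z \<omega> j) - real r * \<epsilon>"
        using \<mu> by (simp add: mult_left_mono)
      finally have "\<theta> / \<sigma> * monitor a ?x r \<le> \<theta> / \<sigma> * (\<sigma> * (\<Sum>j<r. ?z \<omega> j) - real r * \<epsilon>)"
        using \<theta> \<sigma> by (intro mult_left_mono) auto
      also have "\<dots> = (\<theta> / \<sigma> * \<sigma>) * (\<Sum>j<r. ?z \<omega> j) - (\<theta> / \<sigma> * \<epsilon>) * real r"
        by (simp only: right_diff_distrib mult.assoc mult.commute[of "real r"])
      also have "\<dots> = std_walk c \<theta> (?z \<omega>) r"
        using \<sigma> by (simp add: \<epsilon>\<theta> std_walk_def power2_eq_square)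
      finally show ?thesis .
    qed
    have variance: "sample_variance n0 ?x = \<sigma>\<^sup>2 * sq_dev n0 (?z \<omega>) / (real n0 - 1)"
    proof -
      have mean: "sample_mean n0 ?x = \<mu> + \<sigma> * ((\<Sum>j<n0. ?z \<omega> j) / real n0)"
        using n0 unfolding sample_mean_def sum by (simp add: add_divide_distrib)
      have "(\<Sum>j=1..n0. (?x j - sample_mean n0 ?x)\<^sup>2) = (\<Sum>j<n0. (?x (Suc j) - sample_mean n0 ?x)\<^sup>2)"
        by (rule sum.reindex_bij_witness[where i = Suc and j = "\<lambda>j. j - 1"]) auto
      also have "\<dots> = (\<Sum>j<n0. \<sigma>\<^sup>2 * (?z \<omega> j - (\<Sum>j<n0. ?z \<omega> j) / real n0)\<^sup>2)"
        unfolding x mean power_mult_distrib[symmetric] by (simp add: right_diff_distrib)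
      finally show ?thesis
        by (simp add: sample_variance_def sq_dev_def sum_distrib_left)
    qed
    have bound: "\<theta> / \<sigma> * sub_bound c n0 \<eta> \<epsilon> ?x r = std_bound c n0 \<theta> \<eta> (?z \<omega>) r" for r
    proof -
      \<comment> \<open>The factor n0 - 1 of \<open>h_squared\<close> cancels the divisor of the
        sample variance.\<close>
      have h: "h_squared c n0 \<eta> * sample_variance n0 ?x = 2 * real c * \<eta> * \<sigma>\<^sup>2 * sq_dev n0 (?z \<omega>)"
        using n0 by (simp add: variance h_squared_def)
      have "\<theta> / \<sigma> * (2 * real c * \<eta> * \<sigma>\<^sup>2 * q / (2 * real c * \<epsilon>)) = \<eta> / real c * q" for q
        using \<sigma> \<theta> c by (simp add: \<epsilon>\<theta> power2_eq_square)
      moreover have "\<theta> / \<sigma> * (\<epsilon> / (2 * real c) * real r) = \<theta>\<^sup>2 / 2 * real r"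
        using \<sigma> \<theta> c by (simp add: \<epsilon>\<theta> power2_eq_square)
      ultimately have "\<theta> / \<sigma> * (h_squared c n0 \<eta> * sample_variance n0 ?x / (2 * real c * \<epsilon>) - \<epsilon> / (2 * real c) * real r)
        = \<eta> / real c * sq_dev n0 (?z \<omega>) - \<theta>\<^sup>2 / 2 * real r"
        unfolding h right_diff_distrib by simp
      moreover have "\<theta> / \<sigma> * max 0 y = max 0 (\<theta> / \<sigma> * y)" for y
        using max_mult_distrib_left[of "\<theta> / \<sigma>" 0 y] \<theta> \<sigma> by simp
      ultimately show ?thesis by (simp add: sub_bound_def boundary_def std_bound_def)
    qed
    have "first_up n0 (\<lambda>r. \<theta> / \<sigma> * sub_bound c n0 \<eta> \<epsilon> ?x r) (\<lambda>r. \<theta> / \<sigma> * monitor a ?x r)"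
      using up \<theta> \<sigma> by (subst first_up_scale) auto
    then show ?thesis
      unfolding bound by (rule first_up_mono) (rule walk)
  qed
  show ?thesis
  proof (intro bexI conjI)
    show "?z -` ?E \<inter> space M \<in> sets M"
      using measurable_sets[OF Z(1) E] .
    show "{\<omega> \<in> space M. first_up n0 (sub_bound c n0 \<eta> \<epsilon> (\<lambda>j. X j \<omega>)) (monitor a (\<lambda>j. X j \<omega>))} \<subseteq> ?z -` ?E \<inter> space M"
      using sub by auto
    have "emeasure M (?z -` ?E \<inter> space M) = emeasure (distr M \<S> ?z) ?E"
      by (rule emeasure_distr[OF Z(1) E, symmetric])
    also have "\<dots> \<le> ennreal (g_fun c (n0 - 1) \<eta>)"
      unfolding Z(2) using n0 \<eta> by (intro first_up_bound c \<theta>) auto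
    finally show "emeasure M (?z -` ?E \<inter> space M) \<le> ennreal (g_fun c (n0 - 1) \<eta>)" .
  qed
qed

subsection \<open>Marginals of the multivariate normal distribution\<close>

text \<open>The hypothesis \<open>shift\<close> says that \<open>f \<mapsto> \<integral> f / \<phi> d\<kappa>\<close> is translation invariant, where \<open>\<phi>\<close> is the
  normal density; averaging over all translations identifies it with Lebesgue measure.\<close>
lemma normal_from_shift:
  fixes \<kappa> :: "real measure"
  assumes "prob_space \<kappa>" and sets[measurable_cong]: "sets \<kappa> = sets borel" and \<sigma>: "0 < \<sigma>"
    and shift: "\<And>f y. f \<in> borel_measurable borel \<Longrightarrow>
      (\<integral>\<^sup>+w. f w \<partial>\<kappa>) = (\<integral>\<^sup>+w. ennreal (exp (- y * (w - m) / \<sigma>\<^sup>2 - y\<^sup>2 / (2 * \<sigma>\<^sup>2))) * f (w + y) \<partial>\<kappa>)"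
  shows "\<kappa> = density lborel (normal_density m \<sigma>)"
proof -
  interpret \<kappa>: prob_space \<kappa> by fact
  interpret pair_sigma_finite \<kappa> "lborel :: real measure" ..
  let ?\<phi> = "\<lambda>w. ennreal (normal_density m \<sigma> w)"
  have integral_\<phi>: "(\<integral>\<^sup>+y. ?\<phi> y \<partial>lborel) = 1"
    using \<sigma> by (subst nn_integral_eq_integral) auto
  \<comment> \<open>The weight in \<open>shift\<close> is the ratio \<phi>(w + y) /
    \<phi>(w).\<close>
  have \<phi>_shift: "ennreal (exp (- y * (w - m) / \<sigma>\<^sup>2 - y\<^sup>2 / (2 * \<sigma>\<^sup>2))) * ?\<phi> w = ?\<phi> (w + y)" for w y
  proof -
    have "- y * (w - m) / \<sigma>\<^sup>2 - y\<^sup>2 / (2 * \<sigma>\<^sup>2) + - (w - m)\<^sup>2 / (2 * \<sigma>\<^sup>2) = - (w + y - m)\<^sup>2 / (2 * \<sigma>\<^sup>2)"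
      using \<sigma> by (simp add: divide_simps) (simp add: power2_eq_square algebra_simps)
    then show ?thesis
      by (simp add: normal_density_def ennreal_mult'[symmetric] exp_add[symmetric])
  qed
  have eq: "(\<integral>\<^sup>+w. f w \<partial>\<kappa>) = (\<integral>\<^sup>+w. ?\<phi> w * f w \<partial>lborel)" if [measurable]: "f \<in> borel_measurable borel" for f
  proof -
    \<comment> \<open>The averaging over translations starts by inserting the integral of \<phi>(w -
      y) over y, which is 1.\<close>
    have "(\<integral>\<^sup>+w. f w \<partial>\<kappa>) = (\<integral>\<^sup>+w. \<integral>\<^sup>+y. f w * ?\<phi> (w - y) \<partial>lborel \<partial>\<kappa>)"
    proof (rule nn_integral_cong)
      fix w
      have "(\<integral>\<^sup>+y. ?\<phi> (w - y) \<partial>lborel) = 1"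
        using nn_integral_real_affine[of "\<lambda>y. ?\<phi> y" "-1" w] integral_\<phi> by simp
      then show "f w = (\<integral>\<^sup>+y. f w * ?\<phi> (w - y) \<partial>lborel)"
        by (subst nn_integral_cmult) auto
    qed
    also have "\<dots> = (\<integral>\<^sup>+y. \<integral>\<^sup>+w. f w * ?\<phi> (w - y) \<partial>\<kappa> \<partial>lborel)"
      by (rule Fubini'[symmetric]) measurable
    also have "\<dots> = (\<integral>\<^sup>+y. \<integral>\<^sup>+w. ?\<phi> (w + y) * f (w + y) \<partial>\<kappa> \<partial>lborel)"
    proof (rule nn_integral_cong)
      fix y
      show "(\<integral>\<^sup>+w. f w * ?\<phi> (w - y) \<partial>\<kappa>) = (\<integral>\<^sup>+w. ?\<phi> (w + y) * f (w + y) \<partial>\<kappa>)"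
        by (subst shift[of _ y]) (auto simp: \<phi>_shift[symmetric] mult_ac)
    qed
    also have "\<dots> = (\<integral>\<^sup>+w. \<integral>\<^sup>+y. ?\<phi> (w + y) * f (w + y) \<partial>lborel \<partial>\<kappa>)"
      by (rule Fubini') measurable
    also have "\<dots> = (\<integral>\<^sup>+w. (\<integral>\<^sup>+y. ?\<phi> y * f y \<partial>lborel) \<partial>\<kappa>)"
    proof (rule nn_integral_cong)
      fix w
      show "(\<integral>\<^sup>+y. ?\<phi> (w + y) * f (w + y) \<partial>lborel) = (\<integral>\<^sup>+y. ?\<phi> y * f y \<partial>lborel)"
        using nn_integral_real_affine[of "\<lambda>y. ?\<phi> y * f y" 1 w] by simp
    qed
    finally show ?thesis by (simp add: \<kappa>.emeasure_space_1)
  qed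
  show ?thesis
  proof (rule measure_eqI)
    fix A assume "A \<in> sets \<kappa>"
    then have [measurable]: "A \<in> sets borel" by (simp add: sets)
    show "emeasure \<kappa> A = emeasure (density lborel ?\<phi>) A"
      using eq[of "indicator A"] by (simp add: emeasure_density sets)
  qed (simp add: sets)
qed

lemma pos_def_matrix_inv:
  fixes \<Sigma> :: "real ^ 'n ^ 'n"
  assumes "pos_def_matrix \<Sigma>"
  shows "matrix_inv \<Sigma> ** \<Sigma> = mat 1" "\<Sigma> ** matrix_inv \<Sigma> = mat 1"
proof -
  have "x = 0" if "\<Sigma> *v x = 0" for x
    using assms that by (force simp: pos_def_matrix_def)
  then have "invertible \<Sigma>"
    by (simp add: invertible_left_inverse matrix_left_invertible_ker)
  then show "matrix_inv \<Sigma> ** \<Sigma> = mat 1" "\<Sigma> ** matrix_inv \<Sigma> = mat 1"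
    unfolding invertible_def matrix_inv_def by (auto intro: someI2_ex)
qed

lemma pos_def_matrix_diag_pos:
  assumes "pos_def_matrix \<Sigma>"
  shows "0 < \<Sigma> $ l $ l"
proof -
  have "0 < axis l 1 \<bullet> (\<Sigma> *v axis l 1)"
    using assms by (simp add: pos_def_matrix_def axis_eq_0_iff)
  then show ?thesis
    by (simp add: inner_axis' matrix_vector_mul_component inner_axis)
qed

text \<open>Along the direction \<open>\<Sigma> *v axis l 1\<close> the exponent changes through
  coordinate l alone, since the inverse matrix sends this direction to the axis vector.\<close>

lemma mvn_density_shift:
  fixes \<Sigma> :: "real ^ 'n ^ 'n"
  assumes \<Sigma>: "pos_def_matrix \<Sigma>"
  shows "mvn_density \<mu> \<Sigma> (t *\<^sub>R (\<Sigma> *v axis l 1) + x)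
    = exp (- t * (x $ l - \<mu> $ l) - t\<^sup>2 * \<Sigma> $ l $ l / 2) * mvn_density \<mu> \<Sigma> x"
proof -
  let ?P = "matrix_inv \<Sigma>" and ?e = "axis l 1 :: real ^ 'n"
  let ?v = "\<Sigma> *v ?e" and ?d = "x - \<mu>"
  have Pv: "?P *v ?v = ?e"
    by (simp add: matrix_vector_mul_assoc pos_def_matrix_inv[OF \<Sigma>])
  have vP: "?v \<bullet> (?P *v w) = w $ l" for w
  proof -
    have "?v = ?e v* \<Sigma>"
      using \<Sigma> by (metis pos_def_matrix_def transpose_matrix_vector)
    then have "?v \<bullet> (?P *v w) = ?e \<bullet> (\<Sigma> *v (?P *v w))"
      by (simp add: dot_lmul_matrix)
    also have "\<dots> = w $ l"
      by (simp add: matrix_vector_mul_assoc pos_def_matrix_inv[OF \<Sigma>] inner_axis')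
    finally show ?thesis .
  qed
  have "(t *\<^sub>R ?v + ?d) \<bullet> (?P *v (t *\<^sub>R ?v + ?d))
      = ?d \<bullet> (?P *v ?d) + 2 * t * ?d $ l + t\<^sup>2 * ?v $ l"
    by (simp add: matrix_vector_right_distrib matrix_vector_mult_scaleR Pv vP inner_add_left inner_add_right
        inner_axis power2_eq_square algebra_simps)
  also have "?v $ l = \<Sigma> $ l $ l"
    by (simp add: matrix_vector_mul_component inner_axis)
  finally have quad: "(t *\<^sub>R ?v + ?d) \<bullet> (?P *v (t *\<^sub>R ?v + ?d))
      = ?d \<bullet> (?P *v ?d) + 2 * t * ?d $ l + t\<^sup>2 * \<Sigma> $ l $ l" .
  have shift: "t *\<^sub>R ?v + x - \<mu> = t *\<^sub>R ?v + ?d" by simp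
  have "exp (- (A + 2 * t * D + t\<^sup>2 * S) / 2) = exp (- t * D - t\<^sup>2 * S / 2) * exp (- A / 2)" for A D S :: real
    by (simp add: exp_add[symmetric] field_simps)
  then show ?thesis
    unfolding mvn_density_def shift quad by simp
qed

lemma vec_nth_measurable[measurable]: "(\<lambda>x :: real ^ 'n. x $ l) \<in> borel_measurable borel"
  by (intro borel_measurable_continuous_onI continuous_intros)

lemma mvn_density_measurable[measurable]: "mvn_density \<mu> \<Sigma> \<in> borel_measurable borel"
proof -
  have "continuous_on UNIV (\<lambda>x. matrix_inv \<Sigma> *v (x - \<mu>))"
    by (intro continuous_intros linear_continuous_on_compose[of _ _ "(*v) (matrix_inv \<Sigma>)"]) auto
  then have "continuous_on UNIV (mvn_density \<mu> \<Sigma>)"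
    unfolding mvn_density_def[abs_def] divide_inverse by (intro continuous_intros)
  then show ?thesis by (rule borel_measurable_continuous_onI)
qed

text \<open>Translation along \<open>\<Sigma> *v axis l 1\<close> preserves Lebesgue measure and
  changes the density by a factor depending on coordinate l only. So the marginal satisfies the
  hypothesis of \<open>normal_from_shift\<close>, without integrating out the other
  coordinates.\<close>

lemma (in prob_space) mvn_component:
  fixes X :: "'a \<Rightarrow> real ^ 'n"
  assumes X: "distributed M lborel X (mvn_density \<mu> \<Sigma>)" and \<Sigma>: "pos_def_matrix \<Sigma>"
  shows "distributed M lborel (\<lambda>\<omega>. X \<omega> $ l) (normal_density (\<mu> $ l) (sqrt (\<Sigma> $ l $ l)))"
proof -
  define \<sigma> where "\<sigma> = sqrt (\<Sigma> $ l $ l)"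
  have \<sigma>: "0 < \<sigma>" "\<sigma>\<^sup>2 = \<Sigma> $ l $ l" using pos_def_matrix_diag_pos[OF \<Sigma>, of l] by (auto simp: \<sigma>_def)
  have [measurable]: "X \<in> borel_measurable M"
    using distributed_measurable[OF X] by simp
  let ?p = "\<lambda>x. ennreal (mvn_density \<mu> \<Sigma> x)"
  define \<kappa> where "\<kappa> = distr M borel (\<lambda>\<omega>. X \<omega> $ l)"
  have \<kappa>: "(\<integral>\<^sup>+w. f w \<partial>\<kappa>) = (\<integral>\<^sup>+x. ?p x * f (x $ l) \<partial>lborel)" if [measurable]: "f \<in> borel_measurable borel" for f
  proof -
    have "(\<integral>\<^sup>+w. f w \<partial>\<kappa>) = (\<integral>\<^sup>+\<omega>. f (X \<omega> $ l) \<partial>M)"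
      unfolding \<kappa>_def by (subst nn_integral_distr) auto
    also have "\<dots> = (\<integral>\<^sup>+x. ?p x * f (x $ l) \<partial>lborel)"
      by (rule distributed_nn_integral[OF X, symmetric]) auto
    finally show ?thesis .
  qed
  have "\<kappa> = density lborel (normal_density (\<mu> $ l) \<sigma>)"
  proof (rule normal_from_shift)
    show "prob_space \<kappa>" unfolding \<kappa>_def by (rule prob_space_distr) auto
    fix f :: "real \<Rightarrow> ennreal" and y assume [measurable]: "f \<in> borel_measurable borel"
    \<comment> \<open>Chosen so that coordinate l moves by exactly y.\<close>
    let ?t = "y / \<sigma>\<^sup>2"
    let ?s = "?t *\<^sub>R (\<Sigma> *v axis l 1)"
    let ?E = "\<lambda>w. ennreal (exp (- y * (w - \<mu> $ l) / \<sigma>\<^sup>2 - y\<^sup>2 / (2 * \<sigma>\<^sup>2)))"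
    have s: "?s $ l = y"
      using \<sigma>(1) unfolding \<sigma>(2) using pos_def_matrix_diag_pos[OF \<Sigma>, of l]
      by (simp add: matrix_vector_mul_component inner_axis)
    have p: "?p (?s + x) = ?p x * ?E (x $ l)" for x
    proof -
      have "- ?t * (x $ l - \<mu> $ l) - ?t\<^sup>2 * \<Sigma> $ l $ l / 2 = - y * (x $ l - \<mu> $ l) / \<sigma>\<^sup>2 - y\<^sup>2 / (2 * \<sigma>\<^sup>2)"
        unfolding \<sigma>(2)[symmetric] using \<sigma>(1) by (simp add: power2_eq_square)
      then show ?thesis
        by (simp only: mvn_density_shift[OF \<Sigma>]) (simp add: ennreal_mult'' mult.commute)
    qed
    have "(\<integral>\<^sup>+w. f w \<partial>\<kappa>) = (\<integral>\<^sup>+x. ?p x * f (x $ l) \<partial>distr lborel borel ((+) ?s))"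
      unfolding lborel_distr_plus by (rule \<kappa>) fact
    also have "\<dots> = (\<integral>\<^sup>+x. ?p (?s + x) * f ((?s + x) $ l) \<partial>lborel)"
      by (rule nn_integral_distr) auto
    also have "\<dots> = (\<integral>\<^sup>+x. ?p x * (?E (x $ l) * f (x $ l + y)) \<partial>lborel)"
      unfolding p by (simp only: vector_add_component s mult.assoc add.commute)
    also have "\<dots> = (\<integral>\<^sup>+w. ?E w * f (w + y) \<partial>\<kappa>)"
      by (rule \<kappa>[symmetric]) measurable
    finally show "(\<integral>\<^sup>+w. f w \<partial>\<kappa>) = (\<integral>\<^sup>+w. ?E w * f (w + y) \<partial>\<kappa>)" .
  qed (auto simp: \<kappa>_def \<sigma>)
  then show ?thesis
    unfolding distributed_def by (simp add: \<kappa>_def \<sigma>_def cong: distr_cong)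
qed

subsection \<open>Decisions of the procedure\<close>

lemma monitor_cong:
  assumes "\<And>j. 1 \<le> j \<Longrightarrow> x j = x' j"
  shows "monitor a x = monitor a x'"
  unfolding monitor_def using assms by (intro ext) (auto intro!: sum.cong)

lemma sample_variance_cong:
  assumes "\<And>j. 1 \<le> j \<Longrightarrow> x j = x' j"
  shows "sample_variance n x = sample_variance n x'"
proof -
  have "sample_mean n x = sample_mean n x'"
    unfolding sample_mean_def using assms by (auto intro!: sum.cong)
  then show ?thesis
    unfolding sample_variance_def using assms by (auto intro!: sum.cong)
qed

text \<open>Allows a path restricted to {1..}, whose value at 0 is \<open>undefined\<close>, to
  replace the observation sequence.\<close>

lemma izr_decision_cong:
  assumes "\<And>j. 1 \<le> j \<Longrightarrow> x j = x' j"
  shows "izr_decision c n0 \<eta> q tol E sel x = izr_decision c n0 \<eta> q tol E sel x'"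
proof -
  have "monitor a x = monitor a x'" for a by (rule monitor_cong) (rule assms)
  moreover have "sub_bound c n0 \<eta> \<epsilon> x = sub_bound c n0 \<eta> \<epsilon> x'" for \<epsilon>
    using sample_variance_cong[OF assms] by (intro ext) (simp add: sub_bound_def)
  ultimately show ?thesis
    by (simp add: izr_decision_def izr_outcome_def izr_stop_def agreeing_def sub_decision_def sub_stop_def)
qed

text \<open>Negating the observations exchanges the two boundaries, so that wrong feasible decisions
  reduce to wrong infeasible ones.\<close>

lemma monitor_minus: "monitor (- a) (\<lambda>j. - x j) r = - monitor a x r"
  by (simp add: monitor_def sum_negf)

lemma sub_bound_minus: "sub_bound c n0 \<eta> \<epsilon> (\<lambda>j. - x j) = sub_bound c n0 \<eta> \<epsilon> x"
proof -
  have "sample_mean n0 (\<lambda>j. - x j) = - sample_mean n0 x"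
    by (simp add: sample_mean_def sum_negf)
  then have "sample_variance n0 (\<lambda>j. - x j) = sample_variance n0 x"
    by (simp add: sample_variance_def power2_commute)
  then show ?thesis by (intro ext) (simp add: sub_bound_def)
qed

text \<open>At level \<open>tol\<close> both thresholds equal q, so the two subroutines agree and
  the \<open>LEAST\<close> in \<open>izr_stop\<close> ranges over a nonempty set. For the error
  bound, a wrong final decision is thus shared by both subroutines of some level.\<close>

lemma izr_decision_agrees:
  assumes "tie_rule sel" "tol \<in> E"
  obtains \<epsilon> where "\<epsilon> \<in> E"
    "sub_decision c n0 \<eta> \<epsilon> (thr_U q tol \<epsilon>) x = izr_decision c n0 \<eta> q tol E sel x"
    "sub_decision c n0 \<eta> \<epsilon> (thr_D q tol \<epsilon>) x = izr_decision c n0 \<eta> q tol E sel x"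
proof -
  let ?r = "izr_stop c n0 \<eta> q tol E x"
  have "thr_U q tol tol = q" "thr_D q tol tol = q" by (simp_all add: thr_U_def thr_D_def)
  then have "(tol, sub_decision c n0 \<eta> tol q x) \<in> agreeing c n0 \<eta> q tol E x (sub_stop c n0 \<eta> tol q x)"
    using assms(2) by (simp add: agreeing_def)
  then have "agreeing c n0 \<eta> q tol E x ?r \<noteq> {}"
    unfolding izr_stop_def by (intro LeastI[of "\<lambda>r. agreeing c n0 \<eta> q tol E x r \<noteq> {}"]) blast
  then have "izr_outcome c n0 \<eta> q tol E sel x \<in> agreeing c n0 \<eta> q tol E x ?r"
    using assms(1) by (simp add: izr_outcome_def tie_rule_def Let_def)
  then show ?thesis
    by (intro that[of "fst (izr_outcome c n0 \<eta> q tol E sel x)"])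
       (auto simp: agreeing_def izr_decision_def split_beta)
qed

section \<open>Measurability of the procedure\<close>

context
  fixes \<Omega> :: "'w measure" and x :: "nat \<Rightarrow> 'w \<Rightarrow> real"
  assumes x[measurable]: "\<And>j. 1 \<le> j \<Longrightarrow> x j \<in> borel_measurable \<Omega>"
begin

lemma monitor_measurable: "(\<lambda>\<omega>. monitor a (\<lambda>j. x j \<omega>) r) \<in> borel_measurable \<Omega>"
  unfolding monitor_def by (intro borel_measurable_diff borel_measurable_sum) (auto intro: x)

lemma sub_bound_measurable: "(\<lambda>\<omega>. sub_bound c n0 \<eta> \<epsilon> (\<lambda>j. x j \<omega>) r) \<in> borel_measurable \<Omega>"
proof -
  have [measurable]: "(\<lambda>\<omega>. sample_mean n0 (\<lambda>j. x j \<omega>)) \<in> borel_measurable \<Omega>"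
    unfolding sample_mean_def by (intro borel_measurable_divide borel_measurable_sum) (auto intro: x)
  have [measurable]: "(\<lambda>\<omega>. sample_variance n0 (\<lambda>j. x j \<omega>)) \<in> borel_measurable \<Omega>"
    unfolding sample_variance_def
    by (intro borel_measurable_divide borel_measurable_sum borel_measurable_power borel_measurable_diff) (auto intro: x)
  show ?thesis unfolding sub_bound_def boundary_def by measurable
qed

lemma sub_stop_measurable:
  "(\<lambda>\<omega>. sub_stop c n0 \<eta> \<epsilon> a (\<lambda>j. x j \<omega>)) \<in> measurable \<Omega> (count_space UNIV)"
proof -
  note [measurable] = monitor_measurable sub_bound_measurable
  show ?thesis unfolding sub_stop_def by (intro measurable_Least) measurable
qed

lemma sub_decision_measurable:
  "(\<lambda>\<omega>. sub_decision c n0 \<eta> \<epsilon> a (\<lambda>j. x j \<omega>)) \<in> measurable \<Omega> (count_space UNIV)"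
proof -
  note [measurable] = monitor_measurable sub_bound_measurable
  show ?thesis
    unfolding sub_decision_def Let_def
    by (rule measurable_compose_countable[OF _ sub_stop_measurable]) measurable
qed

text \<open>As E is finite and decisions are 1 or -1, the set of agreeing pairs takes finitely many
  values; composing it with any selection \<open>sel\<close> therefore preserves
  measurability.\<close>

lemma agreeing_measurable:
  assumes "finite E"
  shows "(\<lambda>\<omega>. agreeing c n0 \<eta> q tol E (\<lambda>j. x j \<omega>) r) \<in> measurable \<Omega> (count_space (Pow (E \<times> {1, -1})))"
proof -
  note [measurable] = sub_stop_measurable sub_decision_measurable
  let ?A = "\<lambda>\<omega>. agreeing c n0 \<eta> q tol E (\<lambda>j. x j \<omega>) r"
  have sub: "?A \<omega> \<subseteq> E \<times> {1, -1}" for \<omega>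
    using sub_decision_cases by (fastforce simp: agreeing_def)
  have fin: "finite (E \<times> {1, -1 :: int})" using assms by simp
  have "?A -` {C} \<inter> space \<Omega> \<in> sets \<Omega>" if "C \<in> Pow (E \<times> {1, -1})" for C
  proof -
    have "?A -` {C} \<inter> space \<Omega> = {\<omega> \<in> space \<Omega>. \<forall>p\<in>E \<times> {1, -1}. p \<in> ?A \<omega> \<longleftrightarrow> p \<in> C}"
      using sub that by blast
    also have "\<dots> \<in> sets \<Omega>"
    proof (rule sets.sets_Collect_finite_All[OF _ fin])
      fix p :: "real \<times> int" assume "p \<in> E \<times> {1, -1}"
      show "{\<omega> \<in> space \<Omega>. (p \<in> ?A \<omega>) = (p \<in> C)} \<in> sets \<Omega>"
        unfolding agreeing_def by (cases p) (simp, measurable)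
    qed
    finally show ?thesis .
  qed
  then show ?thesis
    using sub fin by (subst measurable_count_space_eq_countable) (auto intro: countable_finite)
qed

lemma izr_decision_measurable:
  assumes "finite E"
  shows "(\<lambda>\<omega>. izr_decision c n0 \<eta> q tol E sel (\<lambda>j. x j \<omega>)) \<in> measurable \<Omega> (count_space UNIV)"
proof -
  note A = agreeing_measurable[OF assms, of c n0 \<eta> q tol]
  have count: "countable (Pow (E \<times> {1, -1 :: int}))"
    using assms by (intro countable_finite) simp
  have "Measurable.pred \<Omega> (\<lambda>\<omega>. agreeing c n0 \<eta> q tol E (\<lambda>j. x j \<omega>) r \<noteq> {})" for r
    by (rule measurable_compose[OF A]) simp
  then have "(\<lambda>\<omega>. izr_stop c n0 \<eta> q tol E (\<lambda>j. x j \<omega>)) \<in> measurable \<Omega> (count_space UNIV)"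
    unfolding izr_stop_def by (rule measurable_Least)
  then show ?thesis
    unfolding izr_decision_def izr_outcome_def Let_def
    by (rule measurable_compose_countable[rotated, where f = "\<lambda>r \<omega>. snd (sel r (agreeing c n0 \<eta> q tol E (\<lambda>j. x j \<omega>) r))"])
       (rule measurable_compose_countable'[OF _ A count, where f = "\<lambda>C \<omega>. snd (sel r C)" for r], simp)
qed

end

section \<open>Error bounds for one constraint and for one system\<close>

lemma bex_superset: "\<exists>B\<in>\<B>. V \<subseteq> B \<and> P B \<Longrightarrow> U \<subseteq> V \<Longrightarrow> \<exists>B\<in>\<B>. U \<subseteq> B \<and> P B"
  by blast

text \<open>A wrong decision needs both subroutines of some level to err, and only one of them is
  charged: the D-subroutine when the system is feasible, the U-subroutine when it is infeasible. Its
  threshold is exactly that level away from q - tol or q + tol, respectively. Hence the factor T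
  rather than 2 T.\<close>

lemma (in prob_space) incorrect_decision_bound:
  assumes indep: "indep_vars (\<lambda>_. borel) X {1..}"
    and normal: "\<And>j. 1 \<le> j \<Longrightarrow> distributed M lborel (X j) (normal_density \<mu> \<sigma>)"
    and \<sigma>: "0 < \<sigma>" and c: "1 \<le> c" and n0: "2 \<le> n0" and \<eta>: "0 < \<eta>" and tol: "0 < tol"
    and lev: "\<And>t. 1 \<le> t \<Longrightarrow> t \<le> T \<Longrightarrow> tol \<le> lev t" "lev T = tol" "1 \<le> T"
    and sel: "tie_rule sel" and g: "0 \<le> g_fun c (n0 - 1) \<eta>"
  shows "\<exists>B\<in>sets M. space M - correct_decision M \<mu> q tol
      (\<lambda>\<omega>. izr_decision c n0 \<eta> q tol (lev ` {1..T}) sel (\<lambda>j. X j \<omega>)) \<subseteq> B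
    \<and> prob B \<le> real T * g_fun c (n0 - 1) \<eta>"
proof -
  let ?Z = "\<lambda>\<omega>. izr_decision c n0 \<eta> q tol (lev ` {1..T}) sel (\<lambda>j. X j \<omega>)"
  have tol_lev: "tol \<in> lev ` {1..T}" using lev(2,3) by force
  have dec: "\<exists>t\<in>{1..T}. sub_decision c n0 \<eta> (lev t) (thr_U q tol (lev t)) (\<lambda>j. X j \<omega>) = ?Z \<omega>
      \<and> sub_decision c n0 \<eta> (lev t) (thr_D q tol (lev t)) (\<lambda>j. X j \<omega>) = ?Z \<omega>" for \<omega>
    by (rule izr_decision_agrees[OF sel tol_lev, of c n0 \<eta> q "\<lambda>j. X j \<omega>"]) auto
  have Z: "?Z \<omega> = 1 \<or> ?Z \<omega> = -1" for \<omega>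
  proof -
    obtain t where "sub_decision c n0 \<eta> (lev t) (thr_U q tol (lev t)) (\<lambda>j. X j \<omega>) = ?Z \<omega>"
      using dec[of \<omega>] by blast
    then show ?thesis
      using sub_decision_cases[of c n0 \<eta> "lev t" "thr_U q tol (lev t)" "\<lambda>j. X j \<omega>"] by presburger
  qed
  have union: "\<exists>B\<in>sets M. {\<omega> \<in> space M. \<exists>t\<in>{1..T}. W t \<omega>} \<subseteq> B \<and> prob B \<le> real T * g_fun c (n0 - 1) \<eta>"
    if W: "\<And>t. t \<in> {1..T} \<Longrightarrow> \<exists>B\<in>sets M. {\<omega> \<in> space M. W t \<omega>} \<subseteq> B \<and> emeasure M B \<le> ennreal (g_fun c (n0 - 1) \<eta>)" for W
  proof -
    obtain B where B: "\<And>t. t \<in> {1..T} \<Longrightarrow> B t \<in> sets M \<and> {\<omega> \<in> space M. W t \<omega>} \<subseteq> B t \<and> emeasure M (B t) \<le> ennreal (g_fun c (n0 - 1) \<eta>)"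
      using W by metis
    have "prob (B t) \<le> g_fun c (n0 - 1) \<eta>" if "t \<in> {1..T}" for t
      using B[OF that] g by (simp add: emeasure_eq_measure)
    then have "prob (\<Union>t\<in>{1..T}. B t) \<le> (\<Sum>t\<in>{1..T}. g_fun c (n0 - 1) \<eta>)"
      using B by (intro order_trans[OF finite_measure_subadditive_finite] sum_mono) auto
    moreover have "(\<Union>t\<in>{1..T}. B t) \<in> sets M" "{\<omega> \<in> space M. \<exists>t\<in>{1..T}. W t \<omega>} \<subseteq> (\<Union>t\<in>{1..T}. B t)"
      using B by fast+
    ultimately show ?thesis by auto
  qed
  consider "\<mu> \<le> q - tol" | "\<not> \<mu> \<le> q - tol" "q + tol \<le> \<mu>" | "\<not> \<mu> \<le> q - tol" "\<not> q + tol \<le> \<mu>" by blast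
  then show ?thesis
  proof cases
    case 1
    have "\<exists>B\<in>sets M. {\<omega> \<in> space M. \<exists>t\<in>{1..T}. sub_decision c n0 \<eta> (lev t) (thr_D q tol (lev t)) (\<lambda>j. X j \<omega>) = -1} \<subseteq> B
        \<and> prob B \<le> real T * g_fun c (n0 - 1) \<eta>"
    proof (rule union)
      fix t assume "t \<in> {1..T}"
      then have lt: "0 < lev t" using lev(1)[of t] tol by auto
      then have "\<mu> \<le> thr_D q tol (lev t) - lev t" using 1 by (simp add: thr_D_def)
      from wrong_side_prob[OF indep normal \<sigma> lt this c n0 \<eta>]
      show "\<exists>B\<in>sets M. {\<omega> \<in> space M. sub_decision c n0 \<eta> (lev t) (thr_D q tol (lev t)) (\<lambda>j. X j \<omega>) = -1} \<subseteq> B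
        \<and> emeasure M B \<le> ennreal (g_fun c (n0 - 1) \<eta>)"
        by (rule bex_superset) (use infeasible_first_up[OF c lt] in auto)
    qed
    moreover have "space M - correct_decision M \<mu> q tol ?Z
      \<subseteq> {\<omega> \<in> space M. \<exists>t\<in>{1..T}. sub_decision c n0 \<eta> (lev t) (thr_D q tol (lev t)) (\<lambda>j. X j \<omega>) = -1}"
    proof
      fix \<omega> assume "\<omega> \<in> space M - correct_decision M \<mu> q tol ?Z"
      then have "\<omega> \<in> space M" "?Z \<omega> = -1" using 1 Z[of \<omega>] by (auto simp: correct_decision_def)
      then show "\<omega> \<in> {\<omega> \<in> space M. \<exists>t\<in>{1..T}. sub_decision c n0 \<eta> (lev t) (thr_D q tol (lev t)) (\<lambda>j. X j \<omega>) = -1}"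
        using dec[of \<omega>] by auto
    qed
    ultimately show ?thesis by (rule bex_superset)
  next
    case 2
    have indep': "indep_vars (\<lambda>_. borel) (\<lambda>j \<omega>. - X j \<omega>) {1..}"
      by (rule indep_vars_compose2[OF indep]) auto
    have normal': "distributed M lborel (\<lambda>\<omega>. - X j \<omega>) (normal_density (- \<mu>) \<sigma>)" if "1 \<le> j" for j
      using normal_density_affine[OF normal[OF that] \<sigma>, of "-1" 0] by simp
    have "\<exists>B\<in>sets M. {\<omega> \<in> space M. \<exists>t\<in>{1..T}. sub_decision c n0 \<eta> (lev t) (thr_U q tol (lev t)) (\<lambda>j. X j \<omega>) = 1} \<subseteq> B
        \<and> prob B \<le> real T * g_fun c (n0 - 1) \<eta>"
    proof (rule union)
      fix t assume "t \<in> {1..T}"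
      then have lt: "0 < lev t" using lev(1)[of t] tol by auto
      then have "- \<mu> \<le> - thr_U q tol (lev t) - lev t" using 2 by (simp add: thr_U_def)
      from wrong_side_prob[OF indep' normal' \<sigma> lt this c n0 \<eta>]
      show "\<exists>B\<in>sets M. {\<omega> \<in> space M. sub_decision c n0 \<eta> (lev t) (thr_U q tol (lev t)) (\<lambda>j. X j \<omega>) = 1} \<subseteq> B
        \<and> emeasure M B \<le> ennreal (g_fun c (n0 - 1) \<eta>)"
        unfolding sub_bound_minus monitor_minus[abs_def]
        by (rule bex_superset) (use feasible_first_up[OF c lt] in auto)
    qed
    moreover have "space M - correct_decision M \<mu> q tol ?Z
      \<subseteq> {\<omega> \<in> space M. \<exists>t\<in>{1..T}. sub_decision c n0 \<eta> (lev t) (thr_U q tol (lev t)) (\<lambda>j. X j \<omega>) = 1}"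
    proof
      fix \<omega> assume "\<omega> \<in> space M - correct_decision M \<mu> q tol ?Z"
      then have "\<omega> \<in> space M" "?Z \<omega> = 1" using 2 Z[of \<omega>] by (auto simp: correct_decision_def)
      then show "\<omega> \<in> {\<omega> \<in> space M. \<exists>t\<in>{1..T}. sub_decision c n0 \<eta> (lev t) (thr_U q tol (lev t)) (\<lambda>j. X j \<omega>) = 1}"
        using dec[of \<omega>] by auto
    qed
    ultimately show ?thesis by (rule bex_superset)
  next
    case 3
    then show ?thesis using g by (intro bexI[of _ "{}"]) (auto simp: correct_decision_def)
  qed
qed

text \<open>Across constraints only the union bound is used, since the components of an observation
  vector may be dependent.\<close>

lemma (in prob_space) CD_bound:
  fixes X :: "nat \<Rightarrow> 'a \<Rightarrow> real ^ ('s::finite)" and q :: "'s \<Rightarrow> real"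
  assumes iid: "iid_mvn M X \<mu> \<Sigma>" and \<Sigma>: "pos_def_matrix \<Sigma>"
    and c: "1 \<le> c" and n0: "2 \<le> n0" and \<eta>: "0 < \<eta>" and tol: "\<And>l. 0 < tol l"
    and lev: "\<And>l t. 1 \<le> t \<Longrightarrow> t \<le> T l \<Longrightarrow> tol l \<le> lev l t" "\<And>l. lev l (T l) = tol l" "\<And>l. 1 \<le> T l"
    and sel: "\<And>l. tie_rule (sel l)" and g: "0 \<le> g_fun c (n0 - 1) \<eta>"
  defines "A \<equiv> \<Inter>l. correct_decision M (\<mu> $ l) (q l) (tol l)
      (\<lambda>\<omega>. izr_decision c n0 \<eta> (q l) (tol l) (lev l ` {1..T l}) (sel l) (\<lambda>j. X j \<omega> $ l))"
  shows "\<exists>B\<in>sets M. space M - A \<subseteq> B \<and> prob B \<le> real (\<Sum>l\<in>UNIV. T l) * g_fun c (n0 - 1) \<eta>"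
proof -
  let ?C = "\<lambda>l. correct_decision M (\<mu> $ l) (q l) (tol l)
      (\<lambda>\<omega>. izr_decision c n0 \<eta> (q l) (tol l) (lev l ` {1..T l}) (sel l) (\<lambda>j. X j \<omega> $ l))"
  have "\<exists>B. B \<in> sets M \<and> space M - ?C l \<subseteq> B \<and> prob B \<le> real (T l) * g_fun c (n0 - 1) \<eta>" for l
  proof -
    have indep: "indep_vars (\<lambda>_. borel) (\<lambda>j \<omega>. X j \<omega> $ l) {1..}"
      by (rule indep_vars_compose2[where M' = "\<lambda>_. borel" and X = X]) (use iid in \<open>auto simp: iid_mvn_def\<close>)
    have normal: "distributed M lborel (\<lambda>\<omega>. X j \<omega> $ l) (normal_density (\<mu> $ l) (sqrt (\<Sigma> $ l $ l)))" if "1 \<le> j" for j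
      by (rule mvn_component[OF _ \<Sigma>]) (use iid that in \<open>auto simp: iid_mvn_def\<close>)
    have "0 < sqrt (\<Sigma> $ l $ l)" using pos_def_matrix_diag_pos[OF \<Sigma>] by simp
    from incorrect_decision_bound[where lev = "lev l" and T = "T l" and sel = "sel l" and tol = "tol l" and q = "q l",
        OF indep normal this c n0 \<eta> tol lev(1) lev(2) lev(3) sel g]
    show ?thesis by blast
  qed
  then have "\<forall>l. \<exists>B. B \<in> sets M \<and> space M - ?C l \<subseteq> B \<and> prob B \<le> real (T l) * g_fun c (n0 - 1) \<eta>" ..
  from choice[OF this] obtain B where B: "\<And>l. B l \<in> sets M" "\<And>l. space M - ?C l \<subseteq> B l"
    "\<And>l. prob (B l) \<le> real (T l) * g_fun c (n0 - 1) \<eta>"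
    by auto
  have "prob (\<Union>l. B l) \<le> (\<Sum>l\<in>UNIV. real (T l) * g_fun c (n0 - 1) \<eta>)"
    using B by (intro order_trans[OF finite_measure_subadditive_finite] sum_mono) auto
  then have "prob (\<Union>l. B l) \<le> real (\<Sum>l\<in>UNIV. T l) * g_fun c (n0 - 1) \<eta>"
    by (simp add: sum_distrib_right)
  moreover have "space M - A \<subseteq> (\<Union>l. B l)"
    using B(2) by (auto simp: A_def)
  ultimately show ?thesis using B(1) by (intro bexI[of _ "\<Union>l. B l"]) auto
qed

text \<open>Independence of the systems is stated on path space.\<close>
lemma sets_correct_paths:
  fixes q tol :: "'s::finite \<Rightarrow> real" and T :: "'s \<Rightarrow> nat" and lev :: "'s \<Rightarrow> nat \<Rightarrow> real"
  defines "P \<equiv> \<Pi>\<^sub>M j\<in>{1::nat..}. (borel :: (real ^ 's) measure)"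
  shows "(\<Inter>l. correct_decision P (\<mu> $ l) (q l) (tol l)
      (\<lambda>p. izr_decision c n0 \<eta> (q l) (tol l) (lev l ` {1..T l}) (sel l) (\<lambda>j. p j $ l))) \<in> sets P"
proof (intro sets.finite_INT)
  fix l
  have "(\<lambda>p. p j $ l) \<in> borel_measurable P" if "1 \<le> j" for j
  proof -
    have "(\<lambda>p. p j) \<in> measurable P borel"
      unfolding P_def using that by (intro measurable_component_singleton) auto
    from measurable_compose[OF this vec_nth_measurable] show ?thesis .
  qed
  then have dec: "(\<lambda>p. izr_decision c n0 \<eta> (q l) (tol l) (lev l ` {1..T l}) (sel l) (\<lambda>j. p j $ l)) \<in> measurable P (count_space UNIV)"
    by (rule izr_decision_measurable[where x = "\<lambda>j p. p j $ l"]) simp_all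
  have "{p \<in> space P. izr_decision c n0 \<eta> (q l) (tol l) (lev l ` {1..T l}) (sel l) (\<lambda>j. p j $ l) = z} \<in> sets P" for z
    using measurable_sets[OF dec, of "{z}"] by (simp add: vimage_def Int_def conj_commute)
  then show "correct_decision P (\<mu> $ l) (q l) (tol l)
      (\<lambda>p. izr_decision c n0 \<eta> (q l) (tol l) (lev l ` {1..T l}) (sel l) (\<lambda>j. p j $ l)) \<in> sets P"
    by (simp add: correct_decision_def)
qed auto

section \<open>Combination over the systems\<close>

theorem theorem1:
  fixes M :: "'w measure"
    and Y :: "'k::finite \<Rightarrow> nat \<Rightarrow> 'w \<Rightarrow> real ^ ('s::finite)"
    and y :: "'k \<Rightarrow> real ^ 's"
    and \<Sigma> :: "'k \<Rightarrow> real ^ 's ^ 's"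
    and c n0 :: nat
    and \<alpha> \<eta> :: real
    and q tol :: "'s \<Rightarrow> real"
    and T :: "'s \<Rightarrow> nat"
    and lev :: "'s \<Rightarrow> nat \<Rightarrow> real"
    and sel :: "'k \<Rightarrow> 's \<Rightarrow> nat \<Rightarrow> (real \<times> int) set \<Rightarrow> real \<times> int"
  assumes "prob_space M"
    and "\<And>i. pos_def_matrix (\<Sigma> i)"
    and "\<And>i. iid_mvn M (Y i) (y i) (\<Sigma> i)"
    and "n0 \<ge> 2" and "c \<ge> 1"
    and "0 < \<alpha>" and "\<alpha> < 1"
    and "\<And>l. tol l > 0"
    and "\<And>l. T l \<ge> 1"
    and "\<And>l t t'. 1 \<le> t \<Longrightarrow> t < t' \<Longrightarrow> t' \<le> T l \<Longrightarrow> lev l t > lev l t'"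
    and "\<And>l. lev l (T l) = tol l"
    and "\<And>i l. tie_rule (sel i l)"
    and "\<eta> > 0"
  shows "(systems_independent M Y \<and>
            g_fun c (n0 - 1) \<eta> = beta_indep \<alpha> CARD('k) (\<Sum>l\<in>UNIV. T l) \<longrightarrow>
            measure M (\<Inter>i. \<Inter>l. CD M Y y c n0 \<eta> q tol T lev sel i l) \<ge> 1 - \<alpha>) \<and>
         (g_fun c (n0 - 1) \<eta> = beta_dep \<alpha> CARD('k) (\<Sum>l\<in>UNIV. T l) \<longrightarrow>
            measure M (\<Inter>i. \<Inter>l. CD M Y y c n0 \<eta> q tol T lev sel i l) \<ge> 1 - \<alpha>)"
proof -
  interpret prob_space M by fact
  let ?g = "g_fun c (n0 - 1) \<eta>" and ?N = "\<Sum>l\<in>UNIV. T l" and ?k = "CARD('k)"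
  let ?P = "\<Pi>\<^sub>M j\<in>{1::nat..}. (borel :: (real ^ 's) measure)"
  define path where "path i \<omega> = (\<lambda>j\<in>{1..}. Y i j \<omega>)" for i \<omega>
  \<comment> \<open>Correctness is expressed as a set of paths: \<open>A i\<close> is the preimage
    of \<open>D i\<close> under the path map, so independence of the paths carries over to these
    events.\<close>
  define D where "D i = (\<Inter>l. correct_decision ?P (y i $ l) (q l) (tol l)
      (\<lambda>p. izr_decision c n0 \<eta> (q l) (tol l) (lev l ` {1..T l}) (sel i l) (\<lambda>j. p j $ l)))" for i
  define A where "A i = (\<Inter>l. CD M Y y c n0 \<eta> q tol T lev sel i l)" for i
  have D: "D i \<in> sets ?P" for i
    unfolding D_def by (rule sets_correct_paths)
  have path: "path i \<in> measurable M ?P" for i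
  proof -
    have "Y i j \<in> borel_measurable M" if "1 \<le> j" for j
      using assms(3)[of i] that by (auto simp: iid_mvn_def distributed_def)
    then show ?thesis unfolding path_def by (intro measurable_restrict) auto
  qed
  have A_eq: "A i = path i -` D i \<inter> space M" for i
  proof -
    have "izr_decision c n0 \<eta> (q l) (tol l) (lev l ` {1..T l}) (sel i l) (\<lambda>j. Y i j \<omega> $ l)
        = izr_decision c n0 \<eta> (q l) (tol l) (lev l ` {1..T l}) (sel i l) (\<lambda>j. path i \<omega> j $ l)" for l \<omega>
      by (rule izr_decision_cong) (simp add: path_def)
    then have "CD M Y y c n0 \<eta> q tol T lev sel i l = path i -` correct_decision ?P (y i $ l) (q l) (tol l)
      (\<lambda>p. izr_decision c n0 \<eta> (q l) (tol l) (lev l ` {1..T l}) (sel i l) (\<lambda>j. p j $ l)) \<inter> space M" for l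
      using measurable_space[OF path] by (auto simp: CD_def correct_decision_def)
    then show ?thesis unfolding A_def D_def by auto
  qed
  have A[measurable]: "A i \<in> sets M" for i
    unfolding A_eq by (rule measurable_sets[OF path D])
  have lev_ge: "tol l \<le> lev l t" if "1 \<le> t" "t \<le> T l" for l t
    using assms(10)[of t "T l" l] assms(11)[of l] that by (cases "t = T l") auto
  have N: "0 < real ?N"
  proof -
    \<comment> \<open>Any element of the index type, here \<open>undefined\<close>, witnesses that
      the total is positive.\<close>
    have "T undefined \<le> ?N" by (rule member_le_sum) auto
    then show ?thesis using assms(9)[of undefined] by (simp del: of_nat_sum)
  qed
  have k: "0 < real ?k" by simp
  have bound: "1 - real ?N * ?g \<le> prob (A i)" if g: "0 \<le> ?g" for i
  proof -
    have "\<exists>B\<in>sets M. space M - A i \<subseteq> B \<and> prob B \<le> real ?N * ?g"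
      unfolding A_def CD_def
      by (rule CD_bound[OF assms(3,2,5,4,13)]) (use assms(8,9,11,12) lev_ge g in auto)
    then obtain B where B: "B \<in> sets M" "space M - A i \<subseteq> B" "prob B \<le> real ?N * ?g"
      by blast
    have "1 - prob (A i) \<le> prob B"
      using B(1,2) A by (subst prob_compl[symmetric]) (auto intro: finite_measure_mono)
    then show ?thesis using B(3) by linarith
  qed
  have "1 - \<alpha> \<le> prob (\<Inter>i. A i)"
    if ind: "systems_independent M Y" and g: "?g = beta_indep \<alpha> ?k ?N"
  proof -
    \<comment> \<open>The probability required of each system; the product over all k systems is 1 -
      \<alpha>.\<close>
    let ?r = "(1 - \<alpha>) powr (1 / real ?k)"
    have "?r \<le> 1" using assms(6,7) by (intro powr_le1) auto
    then have "0 \<le> ?g"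
      unfolding g beta_indep_def using N by (intro divide_nonneg_pos) auto
    moreover have "real ?N * ?g = 1 - ?r"
      unfolding g beta_indep_def times_divide_eq_right
      by (rule nonzero_mult_div_cancel_left) (use N in linarith)
    ultimately have r: "?r \<le> prob (A i)" for i
      using bound[of i] by linarith
    have "indep_vars (\<lambda>_. ?P) path UNIV"
      using ind unfolding systems_independent_def path_def[abs_def] .
    then have "prob (\<Inter>i. A i) = (\<Prod>i\<in>UNIV. prob (A i))"
      unfolding A_eq by (rule indep_varsD_finite) (use D in auto)
    moreover have "(\<Prod>i\<in>(UNIV :: 'k set). ?r) \<le> (\<Prod>i\<in>UNIV. prob (A i))"
      by (intro prod_mono) (auto intro: r)
    moreover have "(\<Prod>i\<in>(UNIV :: 'k set). ?r) = 1 - \<alpha>"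
      using assms(6,7) by (simp add: powr_power)
    ultimately show ?thesis by simp
  qed
  moreover have "1 - \<alpha> \<le> prob (\<Inter>i. A i)" if g: "?g = beta_dep \<alpha> ?k ?N"
  proof -
    have "0 \<le> ?g"
      unfolding g beta_dep_def using assms(6) N by (intro divide_nonneg_pos mult_pos_pos) auto
    moreover have "real ?N * ?g = \<alpha> / real ?k"
      unfolding g beta_dep_def divide_divide_eq_left[symmetric] times_divide_eq_right[of _ _ "real ?N"]
      by (rule nonzero_mult_div_cancel_left) (use N in linarith)
    ultimately have r: "prob (space M - A i) \<le> \<alpha> / real ?k" for i
      using bound[of i] prob_compl[OF A[of i]] by linarith
    have "1 - prob (\<Inter>i. A i) = prob (space M - (\<Inter>i. A i))"
      by (rule prob_compl[symmetric]) auto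
    also have "\<dots> \<le> prob (\<Union>i. space M - A i)"
      by (rule finite_measure_mono) auto
    also have "\<dots> \<le> (\<Sum>i\<in>(UNIV :: 'k set). \<alpha> / real ?k)"
      by (intro order_trans[OF finite_measure_subadditive_finite] sum_mono r) auto
    also have "\<dots> = \<alpha>" by simp
    finally show ?thesis by simp
  qed
  ultimately show ?thesis unfolding A_def by blast
qed

end
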